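(* Let $X=(a_1,\dots,a_N)$ be a finite ordered list of nonzero vectors spanning the $s$-dimensional vector space $V$. For $\underline b,\underline c\in\mathcal{NB}$, the polynomials $p_{\underline c}$ satisfy the system $$D_{\underline b}\,p_{\underline c}(x_1,\dots,x_s)=\begin{cases}1&\text{if }\underline b=\underline c\\0&\text{if }\underline b\ne\underline c,\end{cases}\qquad D_{\underline b}:=\prod_{a\notin\underline b}a,$$ where $D_{\underline b}\in S[V]$ acts as a differential operator, each $a$ acting as the directional derivative $D_a$. In particular the polynomials $p_{\underline b}$, $\underline b\in\mathcal{NB}$, are linearly independent and are characterized, in the homogeneous component $D(X)_{N-s}$ of degree $N-s$ of $D(X)$, by these equations.
   Context: $V$ is an $s$-dimensional complex vector space, $U=V^*$; $S[V]$ is the algebra of polynomial functions on $U$, also viewed as the algebra of constant coefficient differential operators on $V$, and $S[U]$ is the algebra of polynomial functions on $V$; $x_1,\dots,x_s$ are linear coordinates on $V$. $D_a$ denotes the directional derivative on $S[U]$ for $a\in V$. $X=(a_1,\dots,a_N)$ is an ordered list of nonzero vectors (repetitions allowed) spanning $V$; sublists are identified with index sets, and $\prod_{a\notin\underline b}$ is over the elements of $X$ (by index) not in $\underline b$. A sublist $Y\subset X$ is a cocircuit if $X-Y$ does not span $V$; $D(X)$ is the space of $p\in S[U]$ with $\prod_{x\in Y}D_x\,p=0$ for every cocircuit $Y$. A basis extracted from $X$ is a sublist $\underline b=(a_{i_1},\dots,a_{i_s})$, $i_1<\dots<i_s$, which is a basis of $V$. An element $a_i$ of $X$ breaks $\underline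 b$ if there is $1\le e\le s$ with $i\le i_e$ and $a_i$ in the span of $a_{i_e},\dots,a_{i_s}$; $\underline b$ is no broken if exactly $s$ elements of $X$ (by index) break it. $\mathcal{NB}$ is the set of no broken bases. $R_X:=S[V][\prod_{a\in X}a^{-1}]$; $R_{X,k}$ is the span of the fractions $f\prod_{a\in X}a^{-h_a}$, $f\in S[V]$, $h_a\ge0$, for which the vectors $a$ with $h_a>0$ span a space of dimension $\le k$; $P_X:=R_X/R_{X,s-1}$. An element $p\in S[U]$ acts on $R_X$ and $P_X$ as the constant coefficient differential operator $p(\partial)$ on $U$ ($\phi\in U$ acting as the directional derivative $D_\phi$). $d_X=\prod_{a\in X}a$, $d_{\underline b}=\prod_{a\in\underline b}a$. The polynomials $p_{\underline b}\in S[U]$, $\underline b\in\mathcal{NB}$, are the uniquely determined ones, homogeneous of degree $N-s$ and lying in $D(X)$, such that in $P_X$ $$\Big[\frac1{d_X}\Big]=\sum_{\underline b\in\mathcal{NB}}p_{\underline b}(\partial)\Big[\frac1{d_{\underline b}}\Big].$$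
   Formalization: With the stated action of p(∂), the value of D_b p_c for b = c is (-1)^(N-s) rather than 1 (for X = (a,a), p_b = -x and D_b p_b = -1); the system and the characterization are stated with this corrected sign. *)

theory Defs
  imports
    "HOL-Analysis.Analysis"
    "HOL-Library.Poly_Mapping"
    "HOL-Computational_Algebra.Fraction_Field"
begin

text \<open>
  The complex vector space of dimension \<open>s\<close> is \<open>complex ^ 'n\<close> with \<open>s = CARD('n)\<close> and scalar
  multiplication \<open>(*s)\<close>; its dual \<open>U\<close> is described by the dual basis.  As the ground field is
  infinite, polynomial functions are polynomials.  The same type serves for \<open>S[V]\<close> (the \<open>i\<close>-th
  variable is the \<open>i\<close>-th basis vector of \<open>V\<close>) and for \<open>S[U]\<close> (the \<open>i\<close>-th variable is the
  coordinate \<open>x\<^sub>i\<close> on \<open>V\<close>).  The linear order on the index type is used by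
  \<open>HOL-Library.Poly_Mapping\<close> to show that polynomials form an integral domain.
\<close>

type_synonym 'n mpoly = "('n \<Rightarrow>\<^sub>0 nat) \<Rightarrow>\<^sub>0 complex"

definition mp_const :: "complex \<Rightarrow> 'n mpoly" where
  "mp_const c = Poly_Mapping.single 0 c"

definition mp_var :: "'n \<Rightarrow> 'n mpoly" where
  "mp_var i = Poly_Mapping.single (Poly_Mapping.single i 1) 1"

definition mp_homogeneous :: "nat \<Rightarrow> 'n::finite mpoly \<Rightarrow> bool" where
  "mp_homogeneous k p \<longleftrightarrow> (\<forall>m\<in>Poly_Mapping.keys p. (\<Sum>i\<in>UNIV. Poly_Mapping.lookup m i) = k)"

text \<open>Partial derivative; where \<open>m - single i 1\<close> truncates, the coefficient vanishes.\<close>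

definition mp_pd :: "'n \<Rightarrow> 'n mpoly \<Rightarrow> 'n mpoly" where
  "mp_pd i p = (\<Sum>m\<in>Poly_Mapping.keys p.
     Poly_Mapping.single (m - Poly_Mapping.single i 1)
       (of_nat (Poly_Mapping.lookup m i) * Poly_Mapping.lookup p m))"

lemma mp_pd_superset:
  assumes "finite A" "Poly_Mapping.keys p \<subseteq> A"
  shows "mp_pd i p = (\<Sum>m\<in>A. Poly_Mapping.single (m - Poly_Mapping.single i 1)
     (of_nat (Poly_Mapping.lookup m i) * Poly_Mapping.lookup p m))"
  unfolding mp_pd_def
  by (rule sum.mono_neutral_left) (use assms in \<open>auto simp: in_keys_iff\<close>)

lemma mp_pd_add: "mp_pd i (p + q) = mp_pd i p + mp_pd i q"
proof -
  let ?A = "Poly_Mapping.keys p \<union> Poly_Mapping.keys q"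
  have "Poly_Mapping.keys (p + q) \<subseteq> ?A"
    by (rule Poly_Mapping.keys_add)
  then show ?thesis
    by (simp add: mp_pd_superset[where A = ?A] lookup_add distrib_left single_add sum.distrib)
qed

lemma mp_pd_zero [simp]: "mp_pd i 0 = 0"
  by (simp add: mp_pd_def)

lemma mp_pd_single:
  "mp_pd i (Poly_Mapping.single m c) =
    Poly_Mapping.single (m - Poly_Mapping.single i 1) (of_nat (Poly_Mapping.lookup m i) * c)"
  by (simp add: mp_pd_superset[where A = "{m}"])

lemma mp_pd_mult_single:
  "mp_pd i (Poly_Mapping.single m c * Poly_Mapping.single n d) =
    mp_pd i (Poly_Mapping.single m c) * Poly_Mapping.single n d
    + Poly_Mapping.single m c * mp_pd i (Poly_Mapping.single n d)"
proof -
  have shift: "a - Poly_Mapping.single i 1 + b = a + b - Poly_Mapping.single i 1"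
    if "Poly_Mapping.lookup a i \<noteq> 0" for a b :: "'a \<Rightarrow>\<^sub>0 nat"
    using that
    by (intro poly_mapping_eqI) (auto simp: lookup_add lookup_minus lookup_single when_def)
  have 1: "mp_pd i (Poly_Mapping.single m c) * Poly_Mapping.single n d =
      Poly_Mapping.single (m + n - Poly_Mapping.single i 1)
        (of_nat (Poly_Mapping.lookup m i) * c * d)"
  proof (cases "Poly_Mapping.lookup m i = 0")
    case False
    show ?thesis
      unfolding mp_pd_single mult_single shift[OF False] ..
  qed (simp add: mp_pd_single)
  have 2: "Poly_Mapping.single m c * mp_pd i (Poly_Mapping.single n d) =
      Poly_Mapping.single (m + n - Poly_Mapping.single i 1)
        (c * (of_nat (Poly_Mapping.lookup n i) * d))"
  proof (cases "Poly_Mapping.lookup n i = 0")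
    case False
    have "m + (n - Poly_Mapping.single i 1) = m + n - Poly_Mapping.single i 1"
      using shift[OF False, of m] by (simp only: add.commute)
    then show ?thesis
      unfolding mp_pd_single mult_single by (rule arg_cong)
  qed (simp add: mp_pd_single)
  show ?thesis
    unfolding 1 2 unfolding mult_single mp_pd_single single_add[symmetric]
    by (simp add: lookup_add algebra_simps)
qed

lemma mp_sum_single:
  "(p :: 'n mpoly) = (\<Sum>m\<in>Poly_Mapping.keys p. Poly_Mapping.single m (Poly_Mapping.lookup p m))"
proof (rule poly_mapping_eqI)
  fix k
  have "(\<Sum>m\<in>Poly_Mapping.keys p. Poly_Mapping.lookup p m when m = k) = Poly_Mapping.lookup p k"
    by (cases "k \<in> Poly_Mapping.keys p")
      (auto simp: when_def in_keys_iff sum.delta)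
  then show "Poly_Mapping.lookup p k = Poly_Mapping.lookup
      (\<Sum>m\<in>Poly_Mapping.keys p. Poly_Mapping.single m (Poly_Mapping.lookup p m)) k"
    by (simp add: lookup_sum lookup_single)
qed

lemma mp_pd_sum: "mp_pd i (sum f A) = (\<Sum>x\<in>A. mp_pd i (f x))"
  by (induction A rule: infinite_finite_induct) (simp_all add: mp_pd_add)

lemma mp_pd_mult: "mp_pd i (p * q) = mp_pd i p * q + p * mp_pd i q"
proof -
  define P where "P m = Poly_Mapping.single m (Poly_Mapping.lookup p m)" for m
  define Q where "Q m = Poly_Mapping.single m (Poly_Mapping.lookup q m)" for m
  have "mp_pd i (sum P A * sum Q B) =
      mp_pd i (sum P A) * sum Q B + sum P A * mp_pd i (sum Q B)" for A B
    by (simp add: sum_product mp_pd_sum P_def Q_def mp_pd_mult_single sum.distrib)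
  from this[of "Poly_Mapping.keys p" "Poly_Mapping.keys q"] show ?thesis
    unfolding P_def Q_def mp_sum_single[symmetric] .
qed

text \<open>The element \<open>a\<close> of \<open>V\<close> as a linear form in \<open>S[V]\<close>, and as directional derivative on \<open>S[U]\<close>.\<close>

definition lin_form :: "complex ^ 'n \<Rightarrow> 'n::finite mpoly" where
  "lin_form a = (\<Sum>i\<in>UNIV. mp_const (a $ i) * mp_var i)"

definition dir_deriv :: "complex ^ 'n \<Rightarrow> 'n::finite mpoly \<Rightarrow> 'n mpoly" where
  "dir_deriv a p = (\<Sum>i\<in>UNIV. mp_const (a $ i) * mp_pd i p)"

text \<open>The list \<open>X\<close> is indexed from 0; sublists are sets of indices.\<close>

definition dir_derivs :: "(complex ^ 'n) list \<Rightarrow> nat set \<Rightarrow> 'n::finite mpoly \<Rightarrow> 'n mpoly" where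
  "dir_derivs X Y p = fold (\<lambda>i. dir_deriv (X ! i)) (sorted_list_of_set Y) p"

definition cocircuit :: "(complex ^ 'n::finite) list \<Rightarrow> nat set \<Rightarrow> bool" where
  "cocircuit X Y \<longleftrightarrow> Y \<subseteq> {..<length X} \<and> vec.span ((!) X ` ({..<length X} - Y)) \<noteq> UNIV"

definition D_space :: "(complex ^ 'n) list \<Rightarrow> 'n::finite mpoly set" where
  "D_space X = {p. \<forall>Y. cocircuit X Y \<longrightarrow> dir_derivs X Y p = 0}"

definition D_space_deg :: "(complex ^ 'n) list \<Rightarrow> nat \<Rightarrow> 'n::finite mpoly set" where
  "D_space_deg X k = {p \<in> D_space X. mp_homogeneous k p}"

definition extracted_basis :: "(complex ^ 'n::finite) list \<Rightarrow> nat set \<Rightarrow> bool" where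
  "extracted_basis X b \<longleftrightarrow> b \<subseteq> {..<length X} \<and> inj_on ((!) X) b \<and>
     vec.independent ((!) X ` b) \<and> vec.span ((!) X ` b) = UNIV"

text \<open>Here \<open>j\<close> is the index \<open>i\<^sub>e\<close> of an element of the basis.\<close>

definition breaks :: "(complex ^ 'n::finite) list \<Rightarrow> nat \<Rightarrow> nat set \<Rightarrow> bool" where
  "breaks X i b \<longleftrightarrow> (\<exists>j\<in>b. i \<le> j \<and> X ! i \<in> vec.span ((!) X ` {k\<in>b. j \<le> k}))"

definition no_broken_bases :: "(complex ^ 'n::finite) list \<Rightarrow> nat set set" where
  "no_broken_bases X =
     {b. extracted_basis X b \<and> card {i. i < length X \<and> breaks X i b} = CARD('n)}"

text \<open>
  \<open>R\<^sub>X\<close> is regarded inside the field of fractions of \<open>S[V]\<close>.  The coordinate \<open>x\<^sub>i\<close> acts on fractions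
  as the partial derivative with respect to the \<open>i\<close>-th variable.
\<close>

lift_definition rat_pd ::
  "'n::{finite,linorder} \<Rightarrow> 'n mpoly fract \<Rightarrow> 'n mpoly fract"
  is "\<lambda>i q. (mp_pd i (fst q) * snd q - fst q * mp_pd i (snd q), snd q * snd q)"
proof -
  fix i :: 'n and q r :: "'n mpoly \<times> 'n mpoly"
  assume "fractrel q r"
  then obtain f g h k where qr: "q = (f, g)" "r = (h, k)"
    and nz: "g \<noteq> 0" "k \<noteq> 0" and eq: "f * k = h * g"
    by (cases q, cases r) auto
  have d: "mp_pd i f * k + f * mp_pd i k = mp_pd i h * g + h * mp_pd i g"
    using arg_cong[OF eq, of "mp_pd i"] by (simp add: mp_pd_mult)
  have "(mp_pd i f * g - f * mp_pd i g) * (k * k)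
      = g * k * (mp_pd i f * k + f * mp_pd i k) - g * mp_pd i k * (f * k) - k * mp_pd i g * (f * k)"
    by (simp add: algebra_simps)
  also have "\<dots> = g * k * (mp_pd i h * g + h * mp_pd i g)
      - g * mp_pd i k * (h * g) - k * mp_pd i g * (h * g)"
    unfolding d eq ..
  also have "\<dots> = (mp_pd i h * k - h * mp_pd i k) * (g * g)"
    by (simp add: algebra_simps)
  finally show "fractrel (mp_pd i (fst q) * snd q - fst q * mp_pd i (snd q), snd q * snd q)
      (mp_pd i (fst r) * snd r - fst r * mp_pd i (snd r), snd r * snd r)"
    using nz by (simp add: qr)
qed

lemma rat_pd_Fract:
  "g \<noteq> 0 \<Longrightarrow> rat_pd i (Fract f g) = Fract (mp_pd i f * g - f * mp_pd i g) (g * g)"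
  using rat_pd.abs_eq[of "(f, g)" i] by (simp only: Fract.abs_eq fractrel_iff fst_conv snd_conv
      if_False simp_thms mult_eq_0_iff)

definition rat_scale :: "complex \<Rightarrow> 'n::{finite,linorder} mpoly fract \<Rightarrow> 'n mpoly fract" where
  "rat_scale c q = Fract (mp_const c) 1 * q"

definition mp_scale :: "complex \<Rightarrow> 'n mpoly \<Rightarrow> 'n mpoly" where
  "mp_scale c p = mp_const c * p"

lemma mp_const_simps:
  "mp_const (c + d) = mp_const c + mp_const d"
  "mp_const (c * d) = mp_const c * mp_const d"
  "mp_const 1 = 1"
  by (simp_all add: mp_const_def single_add mult_single)

interpretation ratfun: vector_space rat_scale
proof
  have add: "Fract (f + g) 1 = Fract f 1 + Fract g 1"
    and mult: "Fract (f * g) 1 = Fract f 1 * Fract g 1" for f g :: "'a mpoly"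
    using add_fract[of 1 1 f g] mult_fract[of f 1 g 1] by simp_all
  fix a b :: complex and x y :: "'a mpoly fract"
  show "rat_scale a (x + y) = rat_scale a x + rat_scale a y"
    by (simp only: rat_scale_def distrib_left)
  show "rat_scale (a + b) x = rat_scale a x + rat_scale b x"
    by (simp only: rat_scale_def mp_const_simps add distrib_right)
  show "rat_scale a (rat_scale b x) = rat_scale (a * b) x"
    by (simp only: rat_scale_def mp_const_simps mult mult.assoc)
  show "rat_scale 1 x = x"
    by (simp only: rat_scale_def mp_const_simps One_fract_def[symmetric] mult_1_left)
qed

interpretation mpoly: vector_space mp_scale
  by unfold_locales (simp_all add: mp_scale_def mp_const_simps algebra_simps)

text \<open>
  The operator \<open>p(\<partial>)\<close>.  Commuting it with multiplication by \<open>a \<in> V\<close> gives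
  \<open>a p(\<partial>) u = p(\<partial>) (a u) - (D\<^sub>a p)(\<partial>) u\<close>.  Because of this sign the polynomials \<open>p\<^sub>b\<close> defined
  by the expansion of \<open>1 / d\<^sub>X\<close> in \<open>P\<^sub>X\<close> satisfy \<open>D\<^sub>b p\<^sub>b = (-1)^(N - s)\<close>: for \<open>X = (a, a)\<close> one has
  \<open>1 / a\<^sup>2 = - \<partial>(1 / a)\<close>.
\<close>

definition poly_diffop ::
  "'n mpoly \<Rightarrow> 'n::{finite,linorder} mpoly fract \<Rightarrow> 'n mpoly fract" where
  "poly_diffop p u = (\<Sum>m\<in>Poly_Mapping.keys p. rat_scale (Poly_Mapping.lookup p m)
     (fold (\<lambda>i. rat_pd i ^^ Poly_Mapping.lookup m i) (sorted_list_of_set UNIV) u))"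

definition R_filt ::
  "(complex ^ 'n::{finite,linorder}) list \<Rightarrow> nat \<Rightarrow> 'n mpoly fract set" where
  "R_filt X k = ratfun.span
     {Fract f (\<Prod>i<length X. lin_form (X ! i) ^ h i) | f h.
        vec.dim {X ! i | i. i < length X \<and> h i > 0} \<le> k}"

text \<open>The class in \<open>P\<^sub>X = R\<^sub>X / R\<^sub>X\<^sub>,\<^sub>s\<^sub>-\<^sub>1\<close> of an element of \<open>R\<^sub>X\<close>.\<close>

definition P_class ::
  "(complex ^ 'n::{finite,linorder}) list \<Rightarrow> 'n mpoly fract \<Rightarrow> 'n mpoly fract set" where
  "P_class X u = (\<lambda>r. u + r) ` R_filt X (CARD('n) - 1)"

definition inv_d :: "(complex ^ 'n::{finite,linorder}) list \<Rightarrow> nat set \<Rightarrow> 'n mpoly fract" where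
  "inv_d X Y = Fract 1 (\<Prod>i\<in>Y. lin_form (X ! i))"

end

theory Submission
  imports Defs
    "HOL-Computational_Algebra.Polynomial_Factorial"
    "HOL-Computational_Algebra.Polynomial_FPS"
    "HOL-Computational_Algebra.Formal_Laurent_Series"
begin

text \<open>
  Multiply the expansion of \<open>1 / d\<^sub>X\<close> by \<open>\<Prod>a\<notin>b. a\<close>.  Every \<open>a \<in> V\<close> annihilates the class of
  \<open>1 / d\<^sub>c\<close> in \<open>P\<^sub>X\<close>, so commuting \<open>a\<close> past \<open>p\<^sub>c(\<partial>)\<close> only leaves \<open>- (D\<^sub>a p\<^sub>c)(\<partial>)\<close>, and
  \<open>[1 / d\<^sub>b] = (-1)^(N - s) \<Sum>\<^sub>c (D\<^sub>b p\<^sub>c) [1 / d\<^sub>c]\<close> with constant coefficients.  The equations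
  follow once the classes \<open>[1 / d\<^sub>c]\<close> are linearly independent.  This is shown by induction on the
  number of vectors: the residue along the hyperplane of the last vector \<open>a\<close> lowers the rank of the
  poles, kills \<open>1 / d\<^sub>c\<close> for \<open>a \<notin> c\<close>, and maps the no broken bases containing \<open>a\<close> to those of the
  contraction by \<open>a\<close>.

  For the characterization, let \<open>r \<in> D(X)\<close> be homogeneous of degree \<open>N - s\<close> with \<open>D\<^sub>b r = 0\<close> for
  all no broken bases \<open>b\<close>.  By induction \<open>D\<^sub>a r\<close>, which lies in \<open>D(X - a)\<close>, is zero; hence \<open>r\<close> is a
  polynomial on the contraction, where induction applies again.  If a vector is parallel to \<open>a\<close>, the
  contraction loses vectors and the degree of \<open>r\<close> is too large, so the induction covers all degrees
  \<open>k \<ge> N - s\<close>.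
\<close>

unbundle no Formal_Power_Series.fps_syntax

section \<open>Polynomials and directional derivatives\<close>

lemma mp_const_0 [simp]: "mp_const 0 = 0"
  by (simp add: mp_const_def)

lemma lookup_mp_const_mult: "Poly_Mapping.lookup (mp_const c * p) m = c * Poly_Mapping.lookup p m"
  for p :: "'n mpoly"
proof -
  have "mp_const c * Poly_Mapping.single k d = Poly_Mapping.single k (c * d)"
    for k :: "'n \<Rightarrow>\<^sub>0 nat" and d
    by (simp add: mp_const_def mult_single)
  then have "mp_const c * p = (\<Sum>k\<in>Poly_Mapping.keys p. Poly_Mapping.single k (c * Poly_Mapping.lookup p k))"
    by (subst mp_sum_single[of p]) (simp add: sum_distrib_left)
  then have "Poly_Mapping.lookup (mp_const c * p) m
      = (\<Sum>k\<in>Poly_Mapping.keys p. if k = m then c * Poly_Mapping.lookup p k else 0)"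
    by (simp add: lookup_sum lookup_single when_def)
  then show ?thesis
    by (simp add: in_keys_iff)
qed

lemma monom_minus_plus:
  fixes k :: "'n \<Rightarrow>\<^sub>0 nat"
  assumes "Poly_Mapping.lookup k i \<noteq> 0"
  shows "(k - Poly_Mapping.single i 1) + Poly_Mapping.single i 1 = k"
proof (rule poly_mapping_eqI)
  fix j
  show "Poly_Mapping.lookup ((k - Poly_Mapping.single i 1) + Poly_Mapping.single i 1) j
      = Poly_Mapping.lookup k j"
    using assms by (cases "j = i") (simp_all add: lookup_add lookup_minus lookup_single)
qed

lemma lookup_mp_pd:
  "Poly_Mapping.lookup (mp_pd i p) m =
    of_nat (Poly_Mapping.lookup m i + 1) * Poly_Mapping.lookup p (m + Poly_Mapping.single i 1)"
proof -
  let ?e = "Poly_Mapping.single i (1::nat)"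
  have "Poly_Mapping.lookup (mp_pd i p) m = (\<Sum>k\<in>Poly_Mapping.keys p.
     if k - ?e = m then of_nat (Poly_Mapping.lookup k i) * Poly_Mapping.lookup p k else 0)"
    by (simp add: mp_pd_def lookup_sum lookup_single when_def)
  also have "\<dots> = (\<Sum>k\<in>Poly_Mapping.keys p.
     if k = m + ?e then of_nat (Poly_Mapping.lookup k i) * Poly_Mapping.lookup p k else 0)"
  proof (rule sum.cong, simp)
    fix k
    \<comment> \<open>Truncated subtraction can be undone only where \<open>k\<close> contains the
      variable \<open>i\<close>; elsewhere the exponent factor is zero and both summands
      vanish.\<close>
    have "k - ?e = m \<longleftrightarrow> k = m + ?e" if "Poly_Mapping.lookup k i \<noteq> 0"
      using monom_minus_plus[OF that] by (metis add_diff_cancel_right')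
    then show "(if k - ?e = m then of_nat (Poly_Mapping.lookup k i) * Poly_Mapping.lookup p k else 0)
       = (if k = m + ?e then of_nat (Poly_Mapping.lookup k i) * Poly_Mapping.lookup p k else 0)"
      by auto
  qed
  also have "\<dots> = of_nat (Poly_Mapping.lookup m i + 1) * Poly_Mapping.lookup p (m + ?e)"
    by (simp add: in_keys_iff lookup_add)
  finally show ?thesis .
qed

lemma mp_pd_commute: "mp_pd i (mp_pd j p) = mp_pd j (mp_pd i p)"
  by (rule poly_mapping_eqI)
    (cases "i = j"; simp add: lookup_mp_pd lookup_add lookup_single when_def ac_simps)

lemma mp_pd_const [simp]: "mp_pd i (mp_const c) = 0"
  by (simp add: mp_const_def mp_pd_single)

lemma mp_pd_var: "mp_pd i (mp_var j) = mp_const (if i = j then 1 else 0)"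
  by (auto simp: mp_var_def mp_pd_single mp_const_def lookup_single when_def)

lemma mp_pd_const_mult: "mp_pd i (mp_const c * p) = mp_const c * mp_pd i p"
  by (simp add: mp_pd_mult)

lemma mp_const_neg1: "mp_const (- 1) = - (1 :: 'n mpoly)"
  by (simp add: mp_const_def single_uminus flip: single_one)

section \<open>Linear forms and directional derivatives\<close>

lemma lin_form_add: "lin_form (a + b) = lin_form a + lin_form b"
  by (simp add: lin_form_def mp_const_simps distrib_right sum.distrib)

lemma lin_form_scale: "lin_form (c *s a) = mp_const c * lin_form a"
  by (simp add: lin_form_def mp_const_simps sum_distrib_left mult.assoc)

lemma lin_form_0 [simp]: "lin_form 0 = 0"
  by (simp add: lin_form_def)

lemma lin_form_axis: "lin_form (axis i 1) = mp_var i"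
  unfolding lin_form_def
  by (subst sum.remove[of _ i]) (auto simp: axis_def mp_const_simps intro!: sum.neutral)

lemma mp_pd_lin_form: "mp_pd i (lin_form a) = mp_const (a $ i)"
  by (simp add: lin_form_def mp_pd_sum mp_pd_const_mult mp_pd_var if_distrib mp_const_simps cong: if_cong)

lemma lin_form_eq_0_iff [simp]: "lin_form a = 0 \<longleftrightarrow> a = 0"
proof
  assume "lin_form a = 0"
  then have "mp_const (a $ i) = (0 :: 'a mpoly)" for i
    by (metis mp_pd_lin_form mp_pd_zero)
  then have "a $ i = 0" for i
    by (metis lookup_single_eq lookup_zero mp_const_def)
  then show "a = 0"
    by (simp add: vec_eq_iff)
qed simp

lemma dir_deriv_add_right: "dir_deriv a (p + q) = dir_deriv a p + dir_deriv a q"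
  by (simp add: dir_deriv_def mp_pd_add distrib_left sum.distrib)

lemma dir_deriv_const_mult: "dir_deriv a (mp_const c * p) = mp_const c * dir_deriv a p"
  by (simp add: dir_deriv_def mp_pd_const_mult sum_distrib_left mult.left_commute)

lemma dir_deriv_0_right [simp]: "dir_deriv a 0 = 0"
  by (simp add: dir_deriv_def)

lemma dir_deriv_add_left: "dir_deriv (a + b) p = dir_deriv a p + dir_deriv b p"
  by (simp add: dir_deriv_def mp_const_simps distrib_right sum.distrib)

lemma dir_deriv_scale_left: "dir_deriv (c *s a) p = mp_const c * dir_deriv a p"
  by (simp add: dir_deriv_def mp_const_simps sum_distrib_left mult.assoc)

lemma dir_deriv_0_left [simp]: "dir_deriv 0 p = 0"
  by (simp add: dir_deriv_def)

lemma dir_deriv_axis: "dir_deriv (axis i 1) p = mp_pd i p"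
  unfolding dir_deriv_def
  by (subst sum.remove[of _ i]) (auto simp: axis_def mp_const_simps intro!: sum.neutral)

lemma dir_deriv_commute: "dir_deriv a (dir_deriv b p) = dir_deriv b (dir_deriv a p)"
proof -
  have *: "dir_deriv a (dir_deriv b p)
      = (\<Sum>i\<in>UNIV. \<Sum>j\<in>UNIV. mp_const (a $ i) * (mp_const (b $ j) * mp_pd i (mp_pd j p)))" for a b
    by (simp add: dir_deriv_def mp_pd_sum mp_pd_const_mult sum_distrib_left)
  show ?thesis
    by (subst (2) *, subst sum.swap, subst *) (simp add: mult.left_commute mp_pd_commute)
qed

text \<open>Lets the vanishing of derivatives pass from a set of directions to its span.\<close>

lemma subspace_dir_deriv_kernel: "vec.subspace {w. dir_deriv w p = 0}"
  by (auto simp: vec.subspace_def dir_deriv_add_left dir_deriv_scale_left)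

section \<open>Homogeneous polynomials\<close>

lemma homogeneousD:
  "mp_homogeneous k p \<Longrightarrow> Poly_Mapping.lookup p m \<noteq> 0 \<Longrightarrow> (\<Sum>i\<in>UNIV. Poly_Mapping.lookup m i) = k"
  by (auto simp: mp_homogeneous_def in_keys_iff)

text \<open>The second claim covers \<open>k = 0\<close>, where the truncated degree
  \<open>k - 1\<close> would lose the information that the derivative is zero.\<close>

lemma mp_pd_homogeneous:
  assumes "mp_homogeneous k p"
  shows "mp_homogeneous (k - 1) (mp_pd i p)" and "k = 0 \<Longrightarrow> mp_pd i p = 0"
proof -
  have *: "(\<Sum>j\<in>UNIV. Poly_Mapping.lookup m j) + 1 = k"
    if "Poly_Mapping.lookup (mp_pd i p) m \<noteq> 0" for m
  proof -
    have "Poly_Mapping.lookup p (m + Poly_Mapping.single i 1) \<noteq> 0"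
      using that by (auto simp: lookup_mp_pd)
    from homogeneousD[OF assms this] show ?thesis
      by (simp add: lookup_add sum.distrib lookup_single when_def)
  qed
  then show "mp_homogeneous (k - 1) (mp_pd i p)"
    by (fastforce simp: mp_homogeneous_def in_keys_iff)
  show "mp_pd i p = 0" if "k = 0"
    using * that by (intro poly_mapping_eqI) fastforce
qed

lemma mp_homogeneous_add: "mp_homogeneous k p \<Longrightarrow> mp_homogeneous k q \<Longrightarrow> mp_homogeneous k (p + q)"
  using Poly_Mapping.keys_add[of p q] by (auto simp: mp_homogeneous_def)

lemma mp_homogeneous_const_mult: "mp_homogeneous k p \<Longrightarrow> mp_homogeneous k (mp_const c * p)"
  by (auto simp: mp_homogeneous_def in_keys_iff lookup_mp_const_mult)

lemma mp_homogeneous_0 [simp]: "mp_homogeneous k 0"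
  by (simp add: mp_homogeneous_def)

lemma mp_homogeneous_diff:
  "mp_homogeneous k p \<Longrightarrow> mp_homogeneous k q \<Longrightarrow> mp_homogeneous k (p - q)"
  using mp_homogeneous_add[of k p "mp_const (- 1) * q"] mp_homogeneous_const_mult[of k q "- 1"]
  by (simp add: mp_const_neg1)

lemma mp_homogeneous_sum:
  "(\<And>i. i \<in> A \<Longrightarrow> mp_homogeneous k (f i)) \<Longrightarrow> mp_homogeneous k (sum f A)"
  by (induction A rule: infinite_finite_induct) (simp_all add: mp_homogeneous_add)

lemma dir_deriv_homogeneous:
  assumes "mp_homogeneous k p"
  shows "mp_homogeneous (k - 1) (dir_deriv a p)" and "k = 0 \<Longrightarrow> dir_deriv a p = 0"
proof -
  show "mp_homogeneous (k - 1) (dir_deriv a p)"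
    unfolding dir_deriv_def
    by (intro mp_homogeneous_sum mp_homogeneous_const_mult mp_pd_homogeneous(1) assms)
  show "dir_deriv a p = 0" if "k = 0"
    using mp_pd_homogeneous(2)[OF assms that] by (simp add: dir_deriv_def)
qed

lemma homogeneous_0_const:
  assumes "mp_homogeneous 0 p"
  shows "p = mp_const (Poly_Mapping.lookup p 0)"
proof (rule poly_mapping_eqI)
  fix m
  show "Poly_Mapping.lookup p m = Poly_Mapping.lookup (mp_const (Poly_Mapping.lookup p 0)) m"
  proof (cases "m = 0")
    case False
    then have "(\<Sum>i\<in>UNIV. Poly_Mapping.lookup m i) \<noteq> 0"
      by (auto simp: poly_mapping_eq_iff fun_eq_iff)
    then have "Poly_Mapping.lookup p m = 0"
      using homogeneousD[OF assms, of m] by metis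
    with False show ?thesis
      by (simp add: mp_const_def lookup_single)
  qed (simp add: mp_const_def)
qed

text \<open>A monomial of positive degree contains some variable \<open>i\<close>, and in
  characteristic zero its coefficient survives in \<open>mp_pd i p\<close> up to a nonzero
  factor.\<close>

lemma homogeneous_eq_0_if_derivs_0:
  assumes hom: "mp_homogeneous k p" and k: "k > 0" and d: "\<And>w. dir_deriv w p = 0"
  shows "p = 0"
proof (rule poly_mapping_eqI, rule ccontr)
  fix m
  assume "Poly_Mapping.lookup p m \<noteq> Poly_Mapping.lookup 0 m"
  then have nz: "Poly_Mapping.lookup p m \<noteq> 0" by simp
  with homogeneousD[OF hom] k obtain i where i: "Poly_Mapping.lookup m i \<noteq> 0"
    by (metis (no_types, lifting) not_gr_zero sum.neutral)
  have "m = (m - Poly_Mapping.single i 1) + Poly_Mapping.single i 1"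
    using monom_minus_plus[OF i] by simp
  moreover have "mp_pd i p = 0"
    using d[of "axis i 1"] by (simp add: dir_deriv_axis)
  ultimately show False
    using nz lookup_mp_pd[of i p "m - Poly_Mapping.single i 1"]
    by (metis add_eq_0_iff_both_eq_0 lookup_zero mult_eq_0_iff of_nat_eq_0_iff one_neq_zero)
qed

text \<open>The operators commute, so a fold over the set agrees with \<open>dir_derivs\<close> and
  allows any index to be split off first or last. A family \<open>x\<close> in place of a list can
  be composed with a projection while the indices stay the same.\<close>

definition dd :: "(nat \<Rightarrow> complex ^ 'n) \<Rightarrow> nat set \<Rightarrow> 'n::finite mpoly \<Rightarrow> 'n mpoly" where
  "dd x Y p = Finite_Set.fold (\<lambda>i. dir_deriv (x i)) p Y"

interpretation dir_deriv: comp_fun_commute "\<lambda>i. dir_deriv (x i)" for x :: "nat \<Rightarrow> complex ^ 'n::finite"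
  by standard (simp add: fun_eq_iff dir_deriv_commute)

lemma dir_derivs_eq_dd: "finite Y \<Longrightarrow> dir_derivs X Y p = dd ((!) X) Y p"
  using dir_deriv.fold_set_fold_remdups[where xs = "sorted_list_of_set Y" and x = "(!) X" and y = p]
  by (simp add: dir_derivs_def dd_def distinct_remdups_id)

lemma dd_empty [simp]: "dd x {} p = p"
  by (simp add: dd_def)

lemma dd_insert: "finite Y \<Longrightarrow> i \<notin> Y \<Longrightarrow> dd x (insert i Y) p = dir_deriv (x i) (dd x Y p)"
  by (simp add: dd_def)

lemma dd_insert': "finite Y \<Longrightarrow> i \<notin> Y \<Longrightarrow> dd x (insert i Y) p = dd x Y (dir_deriv (x i) p)"
  by (simp add: dd_def dir_deriv.fold_insert2 del: dir_deriv.fold_insert)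

lemma dd_add: "finite Y \<Longrightarrow> dd x Y (p + q) = dd x Y p + dd x Y q"
  by (induction Y rule: finite_induct) (simp_all add: dd_insert dir_deriv_add_right)

lemma dd_0 [simp]: "finite Y \<Longrightarrow> dd x Y 0 = 0"
  by (induction Y rule: finite_induct) (simp_all add: dd_insert)

lemma dd_const_mult: "finite Y \<Longrightarrow> dd x Y (mp_const c * p) = mp_const c * dd x Y p"
  by (induction Y rule: finite_induct) (simp_all add: dd_insert dir_deriv_const_mult)

lemma dd_diff: "finite Y \<Longrightarrow> dd x Y (p - q) = dd x Y p - dd x Y q"
  using dd_add[of Y x p "- q"] dd_const_mult[of Y x "- 1" q] by (simp add: mp_const_neg1)

lemma dd_sum: "finite Y \<Longrightarrow> dd x Y (sum f A) = (\<Sum>i\<in>A. dd x Y (f i))"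
  by (induction A rule: infinite_finite_induct) (simp_all add: dd_add)

lemma dd_homogeneous: "finite Y \<Longrightarrow> mp_homogeneous k p \<Longrightarrow> mp_homogeneous (k - card Y) (dd x Y p)"
proof (induction Y rule: finite_induct)
  case (insert i Y)
  then show ?case
    using dir_deriv_homogeneous(1)[of "k - card Y" "dd x Y p" "x i"] by (simp add: dd_insert)
qed simp

text \<open>Comparing first derivatives of \<open>r\<close> is enough: the operators commute, so
  each of them can be moved next to \<open>r\<close>.\<close>

lemma dd_cong:
  assumes "finite Y" "\<And>i. i \<in> Y \<Longrightarrow> dir_deriv (x i) r = dir_deriv (y i) r"
  shows "dd x Y r = dd y Y r"
  using assms
proof (induction Y rule: finite_induct)
  case (insert i Y)
  have comm: "dir_deriv a (dd x Y q) = dd x Y (dir_deriv a q)" for x a and q :: "'a mpoly"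
    using insert(1) by (induction Y rule: finite_induct) (simp_all add: dd_insert, metis dir_deriv_commute)
  have "dir_deriv (x i) (dd y Y r) = dir_deriv (y i) (dd y Y r)"
    using insert by (simp add: comm)
  with insert show ?case
    by (simp add: dd_insert)
qed simp

section \<open>No broken bases under deletion and contraction\<close>

text \<open>For \<open>a $ i \<noteq> 0\<close> this is the projection along \<open>a\<close> onto
  the hyperplane where coordinate \<open>i\<close> vanishes. It models the quotient by the line of
  \<open>a\<close> inside the same type, which induction over contractions requires.\<close>

definition proj :: "'n \<Rightarrow> complex ^ 'n \<Rightarrow> complex ^ 'n \<Rightarrow> complex ^ 'n" where
  "proj i a x = x - (x $ i / a $ i) *s a"

lemma proj_self: "a $ i \<noteq> 0 \<Longrightarrow> proj i a a = 0"
  by (simp add: proj_def)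

lemma proj_0 [simp]: "proj i a 0 = 0"
  by (simp add: proj_def)

lemma proj_add: "proj i a (x + y) = proj i a x + proj i a y"
  by (simp add: proj_def vec_eq_iff add_divide_distrib algebra_simps)

lemma proj_scale: "proj i a (c *s x) = c *s proj i a x"
  by (simp add: proj_def vec_eq_iff algebra_simps)

lemma proj_decomp: "x = proj i a x + (x $ i / a $ i) *s a"
  by (simp add: proj_def)

lemma proj_nth: "a $ i \<noteq> 0 \<Longrightarrow> proj i a x $ i = 0"
  by (simp add: proj_def)

lemma linear_proj: "Vector_Spaces.linear (*s) (*s) (proj i a)"
  by (intro Vector_Spaces.linear_iff[THEN iffD2])
     (simp add: proj_add proj_scale vec.vector_space_axioms)

lemma span_proj_image: "vec.span (proj i a ` S) = proj i a ` vec.span S"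
  by (rule module_hom.span_image[OF Vector_Spaces.linear.axioms(3)[OF linear_proj]])

lemma not_in_span_proj_image: "a $ i \<noteq> 0 \<Longrightarrow> a \<notin> vec.span (proj i a ` S)"
proof
  assume a: "a $ i \<noteq> 0" and "a \<in> vec.span (proj i a ` S)"
  then have "a \<in> proj i a ` vec.span S" by (simp only: span_proj_image)
  then obtain y where "a = proj i a y" by (rule imageE)
  then have "a $ i = proj i a y $ i"
    by (rule arg_cong[where f = "\<lambda>v. v $ i"])
  also have "\<dots> = 0" by (rule proj_nth[OF a])
  finally show False using a by contradiction
qed

text \<open>The kernel of the projection is the line of \<open>a\<close>, so vectors with equal
  projections differ by a multiple of \<open>a\<close>.\<close>

lemma in_span_insert_iff:
  assumes "a $ i \<noteq> 0"
  shows "x \<in> vec.span (insert a S) \<longleftrightarrow> proj i a x \<in> vec.span (proj i a ` S)"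
proof
  assume "x \<in> vec.span (insert a S)"
  then obtain k where "x - k *s a \<in> vec.span S"
    by (auto simp: vec.span_insert)
  then have "proj i a (x - k *s a) \<in> vec.span (proj i a ` S)"
    by (auto simp: span_proj_image)
  moreover have "proj i a (x - k *s a) = proj i a x"
    using proj_add[of i a "x - k *s a" "k *s a"] by (simp add: proj_scale proj_self[OF assms])
  ultimately show "proj i a x \<in> vec.span (proj i a ` S)"
    by simp
next
  assume "proj i a x \<in> vec.span (proj i a ` S)"
  then obtain y where y: "y \<in> vec.span S" "proj i a x = proj i a y"
    by (auto simp: span_proj_image)
  define c where "c = x $ i / a $ i - y $ i / a $ i"
  have "x = y + c *s a"
    unfolding c_def using y(2) by (simp add: proj_def vec_eq_iff algebra_simps)
  moreover have "y \<in> vec.span (insert a S)"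
    using y(1) vec.span_mono[of S "insert a S"] by auto
  moreover have "c *s a \<in> vec.span (insert a S)"
    by (intro vec.span_scale vec.span_base) simp
  ultimately show "x \<in> vec.span (insert a S)"
    by (simp only: vec.span_add)
qed

lemma span_insert_proj:
  assumes "a $ i \<noteq> 0"
  shows "vec.span (insert a (proj i a ` S)) = vec.span (insert a S)"
proof -
  have "x \<in> vec.span (insert a (proj i a ` S)) \<longleftrightarrow> x \<in> vec.span (insert a S)" for x
  proof -
    have idem: "proj i a (proj i a y) = proj i a y" for y
      using proj_nth[OF assms, of y] by (simp add: proj_def[of i a "proj i a y"])
    have "proj i a ` proj i a ` S = proj i a ` S"
      by (simp add: image_image idem)
    then show ?thesis
      using in_span_insert_iff[OF assms, of x S] in_span_insert_iff[OF assms, of x "proj i a ` S"]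
      by simp
  qed
  then show ?thesis by blast
qed

text \<open>Replacing \<open>S\<close> by its projection does not change the span together with
  \<open>a\<close>, and \<open>a\<close> lies outside the hyperplane that contains the
  projection.\<close>

lemma dim_insert_proj:
  assumes "a $ i \<noteq> 0"
  shows "vec.dim (insert a S) = Suc (vec.dim (proj i a ` S))"
proof -
  have "vec.dim (insert a S) = vec.dim (insert a (proj i a ` S))"
    using span_insert_proj[OF assms, of S] by (metis vec.dim_span)
  then show ?thesis
    using not_in_span_proj_image[OF assms] by (simp add: vec.dim_insert)
qed

text \<open>Injectivity and independence together say that the dimension of the image equals the
  number of indices. Passing from the projected family to \<open>insert m K\<close> raises both
  numbers by one.\<close>

lemma independent_insert_iff:
  fixes x :: "nat \<Rightarrow> complex ^ 'n"
  assumes "a $ i \<noteq> 0" "finite K" "x m = a" "m \<notin> K"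
  shows "inj_on x (insert m K) \<and> vec.independent (x ` insert m K)
     \<longleftrightarrow> inj_on (proj i a \<circ> x) K \<and> vec.independent ((proj i a \<circ> x) ` K)"
proof -
  have card_iff: "inj_on y L \<and> vec.independent (y ` L) \<longleftrightarrow> vec.dim (y ` L) = card L"
    if "finite L" for y :: "nat \<Rightarrow> complex ^ 'n" and L
  proof
    assume "inj_on y L \<and> vec.independent (y ` L)"
    then show "vec.dim (y ` L) = card L"
      by (simp add: vec.dim_eq_card_independent card_image)
  next
    assume d: "vec.dim (y ` L) = card L"
    have "vec.dim (y ` L) \<le> card (y ` L)"
      using that by (simp add: vec.dim_le_card')
    then have c: "card (y ` L) = card L"
      using card_image_le[OF that, of y] d by simp
    then show "inj_on y L \<and> vec.independent (y ` L)"
      using that d vec.card_le_dim_spanning[of "y ` L" "vec.span (y ` L)"] eq_card_imp_inj_on[OF that c]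
      by (simp add: vec.span_superset)
  qed
  have "finite (insert m K)" using assms(2) by simp
  show ?thesis
    unfolding card_iff[OF \<open>finite (insert m K)\<close>] card_iff[OF \<open>finite K\<close>]
    unfolding image_comp[symmetric] image_insert assms(3) dim_insert_proj[OF assms(1)]
      card_insert_disjoint[OF assms(2,4)] by (rule nat.inject)
qed

definition nb :: "(nat \<Rightarrow> complex ^ 'n::finite) \<Rightarrow> nat set \<Rightarrow> nat set \<Rightarrow> bool" where
  "nb x I b \<longleftrightarrow> b \<subseteq> I \<and> inj_on x b \<and> vec.independent (x ` b) \<and> vec.span (x ` b) = vec.span (x ` I) \<and>
     (\<forall>i\<in>I - b. \<forall>j\<in>b. i \<le> j \<longrightarrow> x i \<notin> vec.span (x ` {k\<in>b. j \<le> k}))"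

lemma nb_deletion:
  assumes "nb x I b" "b \<subseteq> J" "J \<subseteq> I"
  shows "nb x J b" and "vec.span (x ` J) = vec.span (x ` I)"
proof -
  have "vec.span (x ` b) \<subseteq> vec.span (x ` J)" "vec.span (x ` J) \<subseteq> vec.span (x ` I)"
    using assms by (auto intro!: vec.span_mono)
  then show *: "vec.span (x ` J) = vec.span (x ` I)"
    using assms by (auto simp: nb_def)
  show "nb x J b"
    using assms unfolding nb_def * by blast
qed

text \<open>The new index exceeds every index in \<open>b\<close>, so it cannot break
  \<open>b\<close>.\<close>

lemma nb_insert_last:
  assumes "nb x I b" "vec.span (x ` insert m I) = vec.span (x ` I)" "\<And>i. i \<in> I \<Longrightarrow> i < m"
  shows "nb x (insert m I) b"
proof -
  have "b \<subseteq> I" using assms(1) by (simp add: nb_def)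
  then have "\<not> m \<le> j" if "j \<in> b" for j
    using assms(3) that by (auto simp: not_le)
  with assms(1,2) show ?thesis
    unfolding nb_def by blast
qed

text \<open>A vector parallel to the last one either makes \<open>b\<close> dependent, if its index
  is in \<open>b\<close>, or breaks \<open>b\<close> through the tail consisting of \<open>m\<close>
  alone.\<close>

lemma nb_last_not_parallel:
  assumes nb: "nb x (insert m I) b" and "m \<in> b" and I: "\<And>i. i \<in> I \<Longrightarrow> i < m" and "i \<in> I"
    and a: "x m $ l \<noteq> 0" and nz: "x i \<noteq> 0"
  shows "proj l (x m) (x i) \<noteq> 0"
proof
  assume p: "proj l (x m) (x i) = 0"
  then have xi: "x i \<in> vec.span {x m}"
    using in_span_insert_iff[OF a, of "x i" "{}"] by simp
  have im: "i < m" using I \<open>i \<in> I\<close> by simp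
  show False
  proof (cases "i \<in> b")
    case True
    have ne: "x i \<noteq> x m"
      using nb True \<open>m \<in> b\<close> im by (auto simp: nb_def inj_on_def)
    have "x i \<in> vec.span (x ` b - {x i}) "
      using xi vec.span_mono[of "{x m}" "x ` b - {x i}"] ne \<open>m \<in> b\<close> by auto
    then show False
      using nb True by (auto simp: nb_def vec.dependent_def)
  next
    case False
    have "x i \<in> vec.span (x ` {k\<in>b. m \<le> k})"
      using xi vec.span_mono[of "{x m}" "x ` {k\<in>b. m \<le> k}"] \<open>m \<in> b\<close> by auto
    then show False
      using nb False im \<open>i \<in> I\<close> \<open>m \<in> b\<close> by (auto simp: nb_def)
  qed
qed

text \<open>Every tail of \<open>insert m b\<close> contains \<open>m\<close>, so each span
  condition can be read modulo \<open>x m\<close>. Only the tail starting at \<open>m\<close> has no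
  counterpart after contraction; its condition is supplied by the hypothesis that no projected
  vector vanishes.\<close>

lemma nb_contraction:
  assumes fin: "finite I" and I: "\<And>i. i \<in> I \<Longrightarrow> i < m" and a: "x m $ l \<noteq> 0"
    and np: "\<And>i. i \<in> I \<Longrightarrow> proj l (x m) (x i) \<noteq> 0" and b: "b \<subseteq> I"
  shows "nb x (insert m I) (insert m b) \<longleftrightarrow> nb (proj l (x m) \<circ> x) I b"
proof -
  let ?P = "proj l (x m)"
  have m: "m \<notin> I" using I by blast
  have mb: "m \<notin> b" "finite b" using m b fin finite_subset by blast+
  have "vec.span (x ` insert m b) = vec.span (x ` insert m I)
      \<longleftrightarrow> vec.span ((?P \<circ> x) ` b) = vec.span ((?P \<circ> x) ` I)"
  proof -
    have sp: "vec.span (x ` insert m S) = vec.span (insert (x m) (?P ` (x ` S)))" for S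
      by (simp add: span_insert_proj[OF a])
    have "x i \<in> vec.span (x ` insert m b) \<longleftrightarrow> (?P \<circ> x) i \<in> vec.span ((?P \<circ> x) ` b)" for i
      by (simp add: in_span_insert_iff[OF a] image_comp)
    then have f1: "x ` insert m I \<subseteq> vec.span (x ` insert m b) \<longleftrightarrow> (?P \<circ> x) ` I \<subseteq> vec.span ((?P \<circ> x) ` b)"
      by (auto simp: vec.span_base proj_self[OF a] vec.span_zero image_subset_iff)
    have eq: "vec.span (y ` S) = vec.span (y ` T) \<longleftrightarrow> y ` T \<subseteq> vec.span (y ` S)"
      if "S \<subseteq> T" for S T and y :: "nat \<Rightarrow> complex ^ 'n"
      proof
        assume "vec.span (y ` S) = vec.span (y ` T)"
        then show "y ` T \<subseteq> vec.span (y ` S)" by (simp add: vec.span_superset)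
      next
        assume "y ` T \<subseteq> vec.span (y ` S)"
        then have "vec.span (y ` T) \<subseteq> vec.span (y ` S)"
          by (rule vec.span_minimal) (rule vec.subspace_span)
        moreover have "vec.span (y ` S) \<subseteq> vec.span (y ` T)"
          using that by (intro vec.span_mono image_mono)
        ultimately show "vec.span (y ` S) = vec.span (y ` T)" by simp
      qed
    show ?thesis
      unfolding eq[OF insert_mono[OF b], of x] eq[OF b, of "?P \<circ> x"] by (rule f1)
  qed
  moreover have "inj_on x (insert m b) \<and> vec.independent (x ` insert m b)
     \<longleftrightarrow> inj_on (?P \<circ> x) b \<and> vec.independent ((?P \<circ> x) ` b)"
    by (rule independent_insert_iff[OF a \<open>finite b\<close>]) (use mb in auto)
  moreover have "(\<forall>i\<in>insert m I - insert m b. \<forall>j\<in>insert m b. i \<le> j \<longrightarrow> x i \<notin> vec.span (x ` {k\<in>insert m b. j \<le> k}))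
     \<longleftrightarrow> (\<forall>i\<in>I - b. \<forall>j\<in>b. i \<le> j \<longrightarrow> (?P \<circ> x) i \<notin> vec.span ((?P \<circ> x) ` {k\<in>b. j \<le> k}))"
  proof -
    have *: "x i \<in> vec.span (x ` {k\<in>insert m b. j \<le> k}) \<longleftrightarrow> (?P \<circ> x) i \<in> vec.span ((?P \<circ> x) ` {k\<in>b. j \<le> k})"
      if "j \<in> insert m b" for i j
    proof -
      have "{k\<in>insert m b. j \<le> k} = insert m {k\<in>b. j \<le> k}"
        using that I b by (auto intro: less_imp_le)
      then show ?thesis
        by (simp add: in_span_insert_iff[OF a] image_comp)
    qed
    \<comment> \<open>The tail starting at \<open>m\<close> contracts to the empty set, whose span
      is zero.\<close>
    have none: "(?P \<circ> x) i \<notin> vec.span ((?P \<circ> x) ` {k\<in>b. m \<le> k})" if "i \<in> I" for i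
    proof -
      have *: "{k\<in>b. m \<le> k} = {}" using I b by force
      show ?thesis unfolding * using np[OF that] by simp
    qed
    have "insert m I - insert m b = I - b" using m by blast
    moreover have "(\<forall>j\<in>insert m b. i \<le> j \<longrightarrow> x i \<notin> vec.span (x ` {k\<in>insert m b. j \<le> k}))
        \<longleftrightarrow> (\<forall>j\<in>b. i \<le> j \<longrightarrow> (?P \<circ> x) i \<notin> vec.span ((?P \<circ> x) ` {k\<in>b. j \<le> k}))"
      if "i \<in> I - b" for i
    proof -
      have "x i \<notin> vec.span (x ` {k\<in>insert m b. m \<le> k})"
        using *[of m i] none[of i] that by (simp only: insertI1 Diff_iff) simp
      moreover have "x i \<in> vec.span (x ` {k\<in>insert m b. j \<le> k})
          \<longleftrightarrow> (?P \<circ> x) i \<in> vec.span ((?P \<circ> x) ` {k\<in>b. j \<le> k})" if "j \<in> b" for j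
        using *[of j i] that by (simp only: insert_iff simp_thms)
      ultimately show ?thesis
        unfolding ball_simps(7) by (simp only: simp_thms cong: ball_cong)
    qed
    ultimately show ?thesis
      by (simp only: cong: ball_cong)
  qed
  moreover have "insert m b \<subseteq> insert m I \<longleftrightarrow> b \<subseteq> I"
    using b by blast
  ultimately show ?thesis
    unfolding nb_def by (simp only: conj_assoc[symmetric])
qed

section \<open>Uniqueness in D(X)\<close>

text \<open>Once \<open>r\<close> is constant along \<open>a\<close>, a derivative of
  \<open>r\<close> depends on its direction only modulo \<open>a\<close>.\<close>

lemma dd_proj:
  assumes "finite Y" "dir_deriv a r = 0"
  shows "dd (proj l a \<circ> x) Y r = dd x Y r"
proof (rule dd_cong[OF assms(1)])
  fix i
  have "dir_deriv (proj l a (x i) + (x i $ l / a $ l) *s a) r = dir_deriv (proj l a (x i)) r"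
    by (simp only: dir_deriv_add_left dir_deriv_scale_left assms(2)) simp
  then show "dir_deriv ((proj l a \<circ> x) i) r = dir_deriv (x i) r"
    by (simp flip: proj_decomp)
qed

text \<open>The set \<open>W\<close> collects the vectors contracted so far, along which
  \<open>r\<close> is constant; they make up for the directions that \<open>x\<close> I\<open>no
  longer spans. The equations for no broken bases are assumed only in the critical
  degree\<close>card I - vec.dim (x \<open>I)\<close>; in larger degrees the cocircuit equations
  suffice.\<close>

lemma eq_0_if_derivs_0:
  fixes r :: "'n::finite mpoly"
  assumes "finite I" and "\<And>i. i \<in> I \<Longrightarrow> x i \<noteq> 0"
    and "\<And>w. w \<in> W \<Longrightarrow> dir_deriv w r = 0" and "vec.span (x ` I \<union> W) = UNIV"
    and "mp_homogeneous k r" and "card I \<le> k + vec.dim (x ` I)"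
    and "\<And>Y. Y \<subseteq> I \<Longrightarrow> vec.span (x ` (I - Y)) \<noteq> vec.span (x ` I) \<Longrightarrow> dd x Y r = 0"
    and "\<And>b. card I = k + vec.dim (x ` I) \<Longrightarrow> nb x I b \<Longrightarrow> dd x (I - b) r = 0"
  shows "r = 0"
  using assms
proof (induction "card I" arbitrary: I x W k r rule: less_induct)
  case less
  note fin = less.prems(1) and nz = less.prems(2) and W = less.prems(3) and sp = less.prems(4)
    and hom = less.prems(5) and ge = less.prems(6) and coc = less.prems(7) and nbs = less.prems(8)
  show ?case
  proof (cases "I = {}")
    case True
    have "vec.span W \<subseteq> {w. dir_deriv w r = 0}"
      using W by (intro vec.span_minimal subspace_dir_deriv_kernel) auto
    with sp True have d: "dir_deriv w r = 0" for w by auto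
    show ?thesis
    proof (cases "k = 0")
      case False
      then show ?thesis
        using homogeneous_eq_0_if_derivs_0[OF hom _ d] by simp
    next
      case True
      \<comment> \<open>In degree zero the empty set is a no broken basis of the empty family, and
        its equation is \<open>r = 0\<close> itself.\<close>
      then show ?thesis
        using \<open>I = {}\<close> nbs[of "{}"] by (simp add: nb_def vec.independent_empty)
    qed
  next
    case False
    define m where "m = Max I"
    define J where "J = I - {m}"
    have mI: "m \<in> I"
      unfolding m_def by (rule Max_in[OF fin False])
    then have I: "I = insert m J" and mJ: "m \<notin> J" and finJ: "finite J"
      using fin by (auto simp: J_def)
    have lt: "i < m" if "i \<in> J" for i
      using that fin by (auto simp: J_def m_def order.strict_iff_order)
    have cI: "card I = Suc (card J)"
      using I mJ finJ by simp
    obtain l where a: "x m $ l \<noteq> 0"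
      using nz[OF mI] by (auto simp: vec_eq_iff)
    define a where "a = x m"
    let ?P = "proj l a"
    have al: "a $ l \<noteq> 0" using a by (simp add: a_def)
    have deletion: "dir_deriv a r = 0"
    proof (cases "vec.span (x ` J) = vec.span (x ` I)")
      case False
      \<comment> \<open>If deleting \<open>m\<close> lowers the span, the singleton of
        \<open>m\<close> is a cocircuit.\<close>
      then show ?thesis
        using coc[of "{m}"] mI by (simp add: J_def a_def dd_insert)
    next
      case True
      show ?thesis
      proof (cases "k = 0")
        case True
        then show ?thesis using dir_deriv_homogeneous(2)[OF hom] by simp
      next
        case k: False
        have dim: "vec.dim (x ` J) = vec.dim (x ` I)"
          using True by (rule vec.span_eq_dim)
        show ?thesis
        \<comment> \<open>Induction on the deletion, applied to the derivative along
          \<open>a\<close>. Adding \<open>m\<close> turns a cocircuit of \<open>J\<close> into one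
          of \<open>I\<close>; a no broken basis of \<open>J\<close> remains one for
          \<open>I\<close>, and its complement gains \<open>m\<close>.\<close>
        proof (rule less.hyps[of J x W _ "k - 1"])
          show "card J < card I" using cI by simp
          show "finite J" by fact
          show "x i \<noteq> 0" if "i \<in> J" for i using nz that I by blast
          show "dir_deriv w (dir_deriv a r) = 0" if "w \<in> W" for w
            using W[OF that] by (simp add: dir_deriv_commute[of w])
          show "vec.span (x ` J \<union> W) = UNIV"
            using sp by (simp only: vec.span_Un True)
          show "mp_homogeneous (k - 1) (dir_deriv a r)"
            by (rule dir_deriv_homogeneous(1)[OF hom])
          show "card J \<le> k - 1 + vec.dim (x ` J)"
            using ge cI k dim by simp
          show "dd x Y (dir_deriv a r) = 0"
            if Y: "Y \<subseteq> J" "vec.span (x ` (J - Y)) \<noteq> vec.span (x ` J)" for Y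
          proof -
            have "I - insert m Y = J - Y" "m \<notin> Y" "insert m Y \<subseteq> I" "finite Y"
              using Y(1) I mJ finJ by (auto intro: finite_subset)
            then show ?thesis
              using coc[of "insert m Y"] Y(2) True by (simp add: dd_insert' a_def)
          qed
          show "dd x (J - b) (dir_deriv a r) = 0"
            if b: "card J = k - 1 + vec.dim (x ` J)" "nb x J b" for b
          proof -
            have "nb x I b"
              unfolding I by (rule nb_insert_last[OF b(2)]) (use True I lt in auto)
            moreover have "b \<subseteq> J" using b(2) by (simp add: nb_def)
            then have "I - b = insert m (J - b)" "m \<notin> J - b" "finite (J - b)"
              using I mJ finJ by auto
            moreover have "card I = k + vec.dim (x ` I)"
              using b(1) cI k dim by simp
            ultimately show ?thesis
              using nbs[of b] by (simp add: dd_insert' a_def)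
          qed
        qed
      qed
    qed
    define y where "y = ?P \<circ> x"
    \<comment> \<open>Vectors parallel to \<open>a\<close> become zero and must be discarded, as the
      induction hypothesis asks for nonzero vectors. The number of vectors may therefore drop by
      more than the rank, hence the inequality between \<open>card I\<close> and
      \<open>k\<close>.\<close>
    define J' where "J' = {i\<in>J. y i \<noteq> 0}"
    have J'J: "J' \<subseteq> J" by (auto simp: J'_def)
    have yr: "dd y Y r = dd x Y r" if "Y \<subseteq> J" for Y
      unfolding y_def using that finJ by (intro dd_proj[OF _ deletion]) (rule finite_subset)
    have sp0: "vec.span (y ` J') = vec.span (y ` J)"
    proof -
      have "insert 0 (y ` J') = insert 0 (y ` J)" by (auto simp: J'_def)
      then show ?thesis by (metis vec.span_insert_0)
    qed
    have dim: "vec.dim (x ` I) = Suc (vec.dim (y ` J'))"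
      using dim_insert_proj[OF al, of "x ` J"] vec.span_eq_dim[OF sp0]
      by (simp add: I a_def y_def image_comp)
    have cJ': "card J' \<le> card J" by (rule card_mono[OF finJ J'J])
    show "r = 0"
    \<comment> \<open>Induction on the contraction, with the same polynomial and degree;
      \<open>a\<close> joins the directions along which \<open>r\<close> is constant.\<close>
    proof (rule less.hyps[of J' y "insert a W" r k])
      show "card J' < card I" using cI cJ' by simp
      show "finite J'" using J'J finJ by (rule finite_subset)
      show "y i \<noteq> 0" if "i \<in> J'" for i using that by (simp add: J'_def)
      show "dir_deriv w r = 0" if "w \<in> insert a W" for w
        using that deletion by (elim insertE) (simp_all only: W)
      show "vec.span (y ` J' \<union> insert a W) = UNIV"
      proof -
        have "vec.span (insert a (y ` J')) = vec.span (insert a (y ` J))"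
          unfolding insert_is_Un[of a "y ` J'"] insert_is_Un[of a "y ` J"] vec.span_Un sp0 ..
        also have "\<dots> = vec.span (x ` I)"
          using span_insert_proj[OF al, of "x ` J"] by (simp add: I a_def y_def image_comp)
        finally have "vec.span (insert a (y ` J')) = vec.span (x ` I)" .
        then have "vec.span (insert a (y ` J') \<union> W) = vec.span (x ` I \<union> W)"
          unfolding vec.span_Un by (simp only:)
        then show ?thesis using sp by simp
      qed
      show "mp_homogeneous k r" by fact
      show "card J' \<le> k + vec.dim (y ` J')"
        using ge cI cJ' dim by simp
      show "dd y Y r = 0" if Y: "Y \<subseteq> J'" "vec.span (y ` (J' - Y)) \<noteq> vec.span (y ` J')" for Y
      proof -
        have "vec.span (x ` (I - Y)) \<noteq> vec.span (x ` I)"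
        proof
          assume "vec.span (x ` (I - Y)) = vec.span (x ` I)"
          then have "vec.span (?P ` (x ` (I - Y))) = vec.span (?P ` (x ` I))"
            by (simp only: span_proj_image)
          moreover have "insert 0 (?P ` (x ` (I - Y))) = insert 0 (y ` (J' - Y))"
            using proj_self[OF al] by (auto simp: J'_def y_def I a_def)
          moreover have "insert 0 (?P ` (x ` I)) = insert 0 (y ` J')"
            using proj_self[OF al] by (auto simp: J'_def y_def I a_def)
          ultimately show False using Y(2) by (metis vec.span_insert_0)
        qed
        moreover have "Y \<subseteq> I" "Y \<subseteq> J" using Y(1) J'J I by auto
        ultimately show ?thesis using coc yr by simp
      qed
      show "dd y (J' - b) r = 0" if b: "card J' = k + vec.dim (y ` J')" "nb y J' b" for b
      proof -
        \<comment> \<open>Critical degree for the contraction leaves no room in the inequality for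
          \<open>I\<close>: no vector was parallel to \<open>a\<close>, so no broken bases can be
          lifted.\<close>
        have "card J' = card J" using b(1) ge cI cJ' dim by simp
        then have J'_eq: "J' = J" using card_subset_eq[OF finJ J'J] by simp
        have bJ: "b \<subseteq> J" using b(2) by (simp add: nb_def J'_eq)
        have np: "proj l (x m) (x i) \<noteq> 0" if "i \<in> J" for i
          using that J'_eq by (auto simp: J'_def y_def a_def)
        have "nb x (insert m J) (insert m b) \<longleftrightarrow> nb (proj l (x m) \<circ> x) J b"
          by (rule nb_contraction[of J m x l]) (fact finJ lt a np bJ)+
        then have "nb x I (insert m b)"
          using b(2) by (simp add: I J'_eq y_def a_def)
        moreover have "I - insert m b = J - b" using I mJ by auto
        moreover have "card I = k + vec.dim (x ` I)"
          using b(1) cI dim J'_eq by simp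
        ultimately show ?thesis
          using nbs[of "insert m b"] yr[of "J - b"] by (simp add: J'_eq)
      qed
    qed
  qed
qed

section \<open>Differential operators on fractions\<close>

lemma rat_pd_add: "rat_pd i (u + v) = rat_pd i u + rat_pd i v"
  by (cases u, cases v) (simp add: rat_pd_Fract eq_fract mp_pd_mult mp_pd_add algebra_simps)

lemma rat_pd_mult: "rat_pd i (u * v) = rat_pd i u * v + u * rat_pd i v"
  by (cases u, cases v) (simp add: rat_pd_Fract eq_fract mp_pd_mult algebra_simps)

lemma mp_pd_1 [simp]: "mp_pd i 1 = 0"
  using mp_pd_const[of i 1] by (simp add: mp_const_simps)

lemma rat_pd_to_fract: "rat_pd i (to_fract f) = to_fract (mp_pd i f)"
  by (simp add: to_fract_def rat_pd_Fract)

lemma rat_scale_eq: "rat_scale c u = to_fract (mp_const c) * u"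
  by (simp add: rat_scale_def to_fract_def)

lemma rat_pd_scale: "rat_pd i (rat_scale c u) = rat_scale c (rat_pd i u)"
  by (simp add: rat_scale_eq rat_pd_mult rat_pd_to_fract)

text \<open>Differentiate \<open>u * inverse u = 1\<close>; for \<open>u = 0\<close> both sides
  vanish because \<open>inverse 0 = 0\<close>.\<close>

lemma rat_pd_inverse: "rat_pd i (inverse u) = - rat_pd i u * inverse u * inverse u"
proof (cases "u = 0")
  case True
  have "rat_pd i 0 = (0 :: 'a mpoly fract)"
    using rat_pd_to_fract[of i 0] by simp
  with True show ?thesis by simp
next
  case False
  have "rat_pd i u * inverse u + u * rat_pd i (inverse u) = rat_pd i (to_fract 1)"
    using False by (subst rat_pd_mult[symmetric]) simp
  also have "\<dots> = 0"
    by (simp only: rat_pd_to_fract mp_pd_1 to_fract_0)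
  finally have "u * rat_pd i (inverse u) = - rat_pd i u * inverse u"
    by (simp add: add_eq_0_iff)
  then have "inverse u * (u * rat_pd i (inverse u)) = inverse u * (- rat_pd i u * inverse u)"
    by (rule arg_cong)
  then show ?thesis
    using False by (simp add: mult.assoc[symmetric])
qed

section \<open>Complex-linear operators on fractions\<close>

definition rat_linear :: "('n::{finite,linorder} mpoly fract \<Rightarrow> 'n mpoly fract) \<Rightarrow> bool" where
  "rat_linear f \<longleftrightarrow> (\<forall>u v. f (u + v) = f u + f v) \<and> (\<forall>c u. f (rat_scale c u) = rat_scale c (f u))"

lemma rat_linear_add: "rat_linear f \<Longrightarrow> f (u + v) = f u + f v"
  and rat_linear_scale: "rat_linear f \<Longrightarrow> f (rat_scale c u) = rat_scale c (f u)"
  by (simp_all add: rat_linear_def)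

lemma rat_linear_0: "rat_linear f \<Longrightarrow> f 0 = 0"
  using rat_linear_scale[of f 0 0] by simp

lemma rat_linear_diff: "rat_linear f \<Longrightarrow> f (u - v) = f u - f v"
  using rat_linear_add[of f "u - v" v] by simp

lemma rat_linear_sum: "rat_linear f \<Longrightarrow> f (sum g A) = (\<Sum>x\<in>A. f (g x))"
  by (induction A rule: infinite_finite_induct) (simp_all add: rat_linear_0 rat_linear_add)

lemma rat_linear_mult: "rat_linear (\<lambda>u. w * u)"
  by (simp add: rat_linear_def rat_scale_eq distrib_left mult_ac)

lemma rat_linear_pd: "rat_linear (rat_pd i)"
  by (simp add: rat_linear_def rat_pd_add rat_pd_scale)

lemma rat_linear_funpow: "rat_linear f \<Longrightarrow> rat_linear (f ^^ k)"
  by (induction k) (simp_all add: rat_linear_def)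

lemma rat_linear_fold: "(\<And>i. rat_linear (f i)) \<Longrightarrow> rat_linear (fold f L)"
  by (induction L) (simp_all add: rat_linear_def)

text \<open>A monomial differential operator with an arbitrary list of variables, so that
  commutation rules can be proved by induction on the list.\<close>

definition fold_pd :: "'n list \<Rightarrow> ('n \<Rightarrow> nat) \<Rightarrow> 'n::{finite,linorder} mpoly fract \<Rightarrow> 'n mpoly fract" where
  "fold_pd L e u = fold (\<lambda>i. rat_pd i ^^ e i) L u"

lemma rat_linear_fold_pd: "rat_linear (fold_pd L e)"
  unfolding fold_pd_def[abs_def] by (intro rat_linear_fold rat_linear_funpow rat_linear_pd)

lemma fold_pd_Cons: "fold_pd (j # L) e u = fold_pd L e ((rat_pd j ^^ e j) u)"
  by (simp add: fold_pd_def)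

lemma fold_pd_cong: "(\<And>j. j \<in> set L \<Longrightarrow> e j = e' j) \<Longrightarrow> fold_pd L e u = fold_pd L e' u"
  unfolding fold_pd_def by (intro fold_cong) auto

lemma mult_var_rat_pd:
  "to_fract (mp_var i) * rat_pd j u = rat_pd j (to_fract (mp_var i) * u) - rat_scale (if i = j then 1 else 0) u"
  by (simp add: rat_pd_mult rat_pd_to_fract mp_pd_var rat_scale_eq)

text \<open>Iteration of the Leibniz rule. At \<open>k = 0\<close> the truncated exponent
  \<open>k - 1\<close> is harmless since its coefficient is zero.\<close>

lemma mult_var_rat_pd_pow:
  "to_fract (mp_var i) * (rat_pd j ^^ k) u = (rat_pd j ^^ k) (to_fract (mp_var i) * u)
    - rat_scale (if i = j then of_nat k else 0) ((rat_pd j ^^ (k - 1)) u)"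
proof (induction k)
  case (Suc k)
  have "to_fract (mp_var i) * (rat_pd j ^^ Suc k) u
      = rat_pd j (to_fract (mp_var i) * (rat_pd j ^^ k) u) - rat_scale (if i = j then 1 else 0) ((rat_pd j ^^ k) u)"
    by (simp add: mult_var_rat_pd)
  also have "rat_pd j (to_fract (mp_var i) * (rat_pd j ^^ k) u) = (rat_pd j ^^ Suc k) (to_fract (mp_var i) * u)
      - rat_scale (if i = j then of_nat k else 0) (rat_pd j ((rat_pd j ^^ (k - 1)) u))"
    unfolding Suc by (simp add: rat_linear_diff[OF rat_linear_pd] rat_pd_scale)
  also have "rat_scale (if i = j then of_nat k else 0) (rat_pd j ((rat_pd j ^^ (k - 1)) u))
      = rat_scale (if i = j then of_nat k else 0) ((rat_pd j ^^ k) u)"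
    by (cases k) simp_all
  finally show ?case
    by (auto simp: ratfun.scale_left_distrib)
qed simp

text \<open>Only the derivatives in variable \<open>i\<close> fail to commute with the
  multiplication; distinctness ensures that this variable occurs at most once.\<close>

lemma mult_var_fold_pd:
  "distinct L \<Longrightarrow> to_fract (mp_var i) * fold_pd L e u = fold_pd L e (to_fract (mp_var i) * u)
    - rat_scale (if i \<in> set L then of_nat (e i) else 0) (fold_pd L (e(i := e i - 1)) u)"
proof (induction L arbitrary: u)
  case Nil
  then show ?case by (simp add: fold_pd_def)
next
  case (Cons j L)
  let ?w = "(rat_pd j ^^ e j) u"
  define e' where "e' = e(i := e i - 1)"
  have IH: "to_fract (mp_var i) * fold_pd L e ?w = fold_pd L e (to_fract (mp_var i) * ?w)
    - rat_scale (if i \<in> set L then of_nat (e i) else 0) (fold_pd L e' ?w)"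
    unfolding e'_def by (rule Cons.IH) (use Cons.prems in simp)
  have "to_fract (mp_var i) * fold_pd (j # L) e u = fold_pd (j # L) e (to_fract (mp_var i) * u)
    - rat_scale (if i \<in> set (j # L) then of_nat (e i) else 0) (fold_pd (j # L) e' u)"
  proof (cases "i = j")
    case True
    with Cons have i: "i \<notin> set L" by simp
    have "fold_pd L e' v = fold_pd L e v" for v
      using i by (intro fold_pd_cong) (auto simp: e'_def)
    moreover have "e' j = e j - 1"
      using True by (simp add: e'_def)
    ultimately show ?thesis
      using IH i True
      by (simp add: fold_pd_Cons mult_var_rat_pd_pow rat_linear_diff[OF rat_linear_fold_pd]
          rat_linear_scale[OF rat_linear_fold_pd])
  next
    case False
    then have "e' j = e j"
      by (simp add: e'_def)
    with IH False show ?thesis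
      by (simp add: fold_pd_Cons mult_var_rat_pd_pow)
  qed
  then show ?case
    by (simp only: e'_def)
qed

section \<open>Polynomial differential operators and their commutators with multiplications\<close>

lemma poly_diffop_superset:
  assumes "finite A" "Poly_Mapping.keys p \<subseteq> A"
  shows "poly_diffop p u = (\<Sum>m\<in>A. rat_scale (Poly_Mapping.lookup p m)
     (fold_pd (sorted_list_of_set UNIV) (Poly_Mapping.lookup m) u))"
  unfolding poly_diffop_def fold_pd_def
  by (rule sum.mono_neutral_left) (use assms in \<open>auto simp: in_keys_iff\<close>)

lemma poly_diffop_single: "poly_diffop (Poly_Mapping.single m c) u =
    rat_scale c (fold_pd (sorted_list_of_set UNIV) (Poly_Mapping.lookup m) u)"
  by (subst poly_diffop_superset[of "{m}"]) auto

lemma poly_diffop_add: "poly_diffop (p + q) u = poly_diffop p u + poly_diffop q u"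
proof -
  let ?A = "Poly_Mapping.keys p \<union> Poly_Mapping.keys q"
  have "Poly_Mapping.keys (p + q) \<subseteq> ?A"
    by (rule Poly_Mapping.keys_add)
  then show ?thesis
    by (simp add: poly_diffop_superset[where A = ?A] lookup_add ratfun.scale_left_distrib sum.distrib)
qed

lemma poly_diffop_0 [simp]: "poly_diffop 0 u = 0"
  by (simp add: poly_diffop_def)

lemma poly_diffop_sum: "poly_diffop (sum f A) u = (\<Sum>x\<in>A. poly_diffop (f x) u)"
  by (induction A rule: infinite_finite_induct) (simp_all add: poly_diffop_add)

lemma poly_diffop_const_mult: "poly_diffop (mp_const c * p) u = rat_scale c (poly_diffop p u)"
proof -
  have "Poly_Mapping.keys (mp_const c * p) \<subseteq> Poly_Mapping.keys p"
    by (auto simp: in_keys_iff lookup_mp_const_mult)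
  then show ?thesis
    by (simp add: poly_diffop_superset[where A = "Poly_Mapping.keys p"] lookup_mp_const_mult
        ratfun.scale_sum_right)
qed

lemma poly_diffop_const: "poly_diffop (mp_const c) u = rat_scale c u"
proof -
  have "fold_pd L (\<lambda>_. 0) u = u" for L
    by (induction L) (simp_all add: fold_pd_def)
  moreover have "Poly_Mapping.lookup (0 :: 'a \<Rightarrow>\<^sub>0 nat) = (\<lambda>_. 0)"
    by (simp add: fun_eq_iff)
  ultimately show ?thesis
    by (simp add: mp_const_def poly_diffop_single)
qed

lemma rat_linear_poly_diffop: "rat_linear (poly_diffop p)"
  unfolding rat_linear_def poly_diffop_superset[OF finite_keys order.refl, abs_def]
  by (simp add: rat_linear_add[OF rat_linear_fold_pd] rat_linear_scale[OF rat_linear_fold_pd]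
      ratfun.scale_right_distrib sum.distrib ratfun.scale_sum_right mult.commute)

text \<open>Both sides are additive in \<open>p\<close>, so the rule for single monomials suffices:
  the commutator differentiates the symbol.\<close>

lemma mult_var_poly_diffop:
  "to_fract (mp_var i) * poly_diffop p u = poly_diffop p (to_fract (mp_var i) * u) - poly_diffop (mp_pd i p) u"
proof -
  let ?L = "sorted_list_of_set (UNIV :: 'a set)"
  have single: "to_fract (mp_var i) * poly_diffop (Poly_Mapping.single m c) u
     = poly_diffop (Poly_Mapping.single m c) (to_fract (mp_var i) * u)
       - poly_diffop (mp_pd i (Poly_Mapping.single m c)) u" for m c
  proof -
    have lk: "Poly_Mapping.lookup (m - Poly_Mapping.single i 1)
        = (Poly_Mapping.lookup m)(i := Poly_Mapping.lookup m i - 1)"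
      by (auto simp: fun_eq_iff lookup_minus lookup_single when_def)
    have "to_fract (mp_var i) * rat_scale c (fold_pd ?L (Poly_Mapping.lookup m) u)
        = rat_scale c (to_fract (mp_var i) * fold_pd ?L (Poly_Mapping.lookup m) u)"
      by (simp add: rat_scale_eq mult_ac)
    also have "\<dots> = rat_scale c (fold_pd ?L (Poly_Mapping.lookup m) (to_fract (mp_var i) * u))
       - rat_scale (of_nat (Poly_Mapping.lookup m i) * c)
           (fold_pd ?L (Poly_Mapping.lookup (m - Poly_Mapping.single i 1)) u)"
      by (subst mult_var_fold_pd) (simp_all add: ratfun.scale_right_diff_distrib lk[unfolded One_nat_def] mult.commute)
    finally show ?thesis
      by (simp only: poly_diffop_single mp_pd_single)
  qed
  have "to_fract (mp_var i) * poly_diffop (\<Sum>m\<in>K. Poly_Mapping.single m (f m)) u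
     = poly_diffop (\<Sum>m\<in>K. Poly_Mapping.single m (f m)) (to_fract (mp_var i) * u)
       - poly_diffop (mp_pd i (\<Sum>m\<in>K. Poly_Mapping.single m (f m))) u" for K f
    by (simp only: poly_diffop_sum mp_pd_sum sum_distrib_left single sum_subtractf)
  from this[of "Poly_Mapping.lookup p" "Poly_Mapping.keys p"] show ?thesis
    by (simp only: mp_sum_single[symmetric])
qed

lemma to_fract_sum: "to_fract (sum f A) = (\<Sum>x\<in>A. to_fract (f x))"
  by (induction A rule: infinite_finite_induct) simp_all

lemma to_fract_prod: "to_fract (prod f A) = (\<Prod>x\<in>A. to_fract (f x))"
  by (induction A rule: infinite_finite_induct) simp_all

lemma to_fract_power: "to_fract (f ^ k) = to_fract f ^ k"
  by (induction k) simp_all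

lemma mult_lin_form_poly_diffop:
  "to_fract (lin_form a) * poly_diffop p u
    = poly_diffop p (to_fract (lin_form a) * u) - poly_diffop (dir_deriv a p) u"
proof -
  have lin: "to_fract (lin_form a) * v = (\<Sum>i\<in>UNIV. rat_scale (a $ i) (to_fract (mp_var i) * v))" for v
    by (simp add: lin_form_def to_fract_sum rat_scale_eq sum_distrib_right mult.assoc)
  show ?thesis
    unfolding lin[of "poly_diffop p u"] lin[of u]
    by (simp add: mult_var_poly_diffop dir_deriv_def poly_diffop_sum poly_diffop_const_mult
        rat_linear_sum[OF rat_linear_poly_diffop] rat_linear_scale[OF rat_linear_poly_diffop]
        ratfun.scale_right_diff_distrib sum_subtractf)
qed

section \<open>Fractions with prescribed poles\<close>

inductive_set localized :: "(complex ^ 'n::{finite,linorder}) set \<Rightarrow> 'n mpoly fract set" for T where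
  poly: "to_fract f \<in> localized T"
| inverse: "t \<in> T \<Longrightarrow> inverse (to_fract (lin_form t)) \<in> localized T"
| add: "u \<in> localized T \<Longrightarrow> v \<in> localized T \<Longrightarrow> u + v \<in> localized T"
| mult: "u \<in> localized T \<Longrightarrow> v \<in> localized T \<Longrightarrow> u * v \<in> localized T"

lemma localized_0: "0 \<in> localized T"
  and localized_1: "1 \<in> localized T"
  using localized.poly[of 0] localized.poly[of 1] by auto

lemma localized_uminus: "u \<in> localized T \<Longrightarrow> - u \<in> localized T"
  using localized.mult[OF localized.poly[of "- 1"]] by fastforce

lemma localized_prod: "(\<And>x. x \<in> A \<Longrightarrow> f x \<in> localized T) \<Longrightarrow> prod f A \<in> localized T"
  by (induction A rule: infinite_finite_induct) (simp_all add: localized_1 localized.mult)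

lemma localized_sum: "(\<And>x. x \<in> A \<Longrightarrow> f x \<in> localized T) \<Longrightarrow> sum f A \<in> localized T"
  by (induction A rule: infinite_finite_induct) (simp_all add: localized_0 localized.add)

lemma localized_power: "u \<in> localized T \<Longrightarrow> u ^ k \<in> localized T"
  by (induction k) (simp_all add: localized_1 localized.mult)

text \<open>Differentiation may raise the order of a pole but creates no new one.\<close>

lemma localized_rat_pd: "u \<in> localized T \<Longrightarrow> rat_pd i u \<in> localized T"
proof (induction rule: localized.induct)
  case (inverse t)
  then show ?case
    by (auto simp: rat_pd_inverse rat_pd_to_fract intro!: localized.mult localized_uminus
        localized.inverse localized.poly)
qed (simp_all add: rat_pd_to_fract rat_pd_add rat_pd_mult localized.intros)

text \<open>
  Unlike \<open>R_filt\<close>, this allows arbitrary linear forms as poles, because the residues below leave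
  the list \<open>X\<close>.  The bound is strict, so that \<open>low_rank 0\<close> is zero.
\<close>

definition low_rank :: "nat \<Rightarrow> 'n::{finite,linorder} mpoly fract set" where
  "low_rank k = ratfun.span (\<Union>T\<in>{T. vec.dim T < k}. localized T)"

lemma low_rank_base: "u \<in> localized T \<Longrightarrow> vec.dim T < k \<Longrightarrow> u \<in> low_rank k"
  unfolding low_rank_def by (rule ratfun.span_base) auto

lemma low_rank_0: "0 \<in> low_rank k"
  and low_rank_add: "u \<in> low_rank k \<Longrightarrow> v \<in> low_rank k \<Longrightarrow> u + v \<in> low_rank k"
  and low_rank_scale: "u \<in> low_rank k \<Longrightarrow> rat_scale c u \<in> low_rank k"
  unfolding low_rank_def
  by (rule ratfun.span_zero ratfun.span_add ratfun.span_scale; assumption)+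

lemma low_rank_sum: "(\<And>x. x \<in> A \<Longrightarrow> f x \<in> low_rank k) \<Longrightarrow> sum f A \<in> low_rank k"
  unfolding low_rank_def by (rule ratfun.span_sum)

text \<open>A linear map has to be checked only on the generators of the span.\<close>

lemma low_rank_induct:
  assumes "rat_linear f" "u \<in> low_rank k"
    and "\<And>T v. vec.dim T < k \<Longrightarrow> v \<in> localized T \<Longrightarrow> f v \<in> low_rank l"
  shows "f u \<in> low_rank l"
proof -
  have "low_rank k \<subseteq> {u. f u \<in> low_rank l}"
    unfolding low_rank_def[of k]
  proof (rule ratfun.span_minimal)
    show "(\<Union>T\<in>{T. vec.dim T < k}. localized T) \<subseteq> {u. f u \<in> low_rank l}"
      using assms(3) by auto
    show "ratfun.subspace {u. f u \<in> low_rank l}"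
      using assms(1) unfolding ratfun.subspace_def
      by (auto simp: rat_linear_0 rat_linear_add rat_linear_scale low_rank_0 low_rank_add low_rank_scale)
  qed
  with assms(2) show ?thesis by auto
qed

lemma low_rank_mult_poly: "u \<in> low_rank k \<Longrightarrow> to_fract f * u \<in> low_rank k"
  by (rule low_rank_induct[OF rat_linear_mult]) (auto intro: low_rank_base localized.intros)

lemma low_rank_rat_pd: "u \<in> low_rank k \<Longrightarrow> rat_pd i u \<in> low_rank k"
  by (rule low_rank_induct[OF rat_linear_pd]) (auto intro: low_rank_base localized_rat_pd)

lemma low_rank_poly_diffop:
  assumes "u \<in> low_rank k"
  shows "poly_diffop p u \<in> low_rank k"
proof -
  have pow: "(rat_pd i ^^ j) v \<in> low_rank k" if "v \<in> low_rank k" for i j v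
    using that by (induction j) (simp_all add: low_rank_rat_pd)
  have "fold_pd L e v \<in> low_rank k" if "v \<in> low_rank k" for L e v
    using that by (induction L arbitrary: v) (simp_all add: fold_pd_def pow)
  then show ?thesis
    using assms unfolding poly_diffop_superset[OF finite_keys order.refl]
    by (intro low_rank_sum low_rank_scale)
qed

text \<open>Allows the expansion in \<open>P_class\<close> to be read modulo the larger space
  \<open>low_rank\<close>, modulo which independence is proved. The successor accounts for the
  strict bound there.\<close>

lemma R_filt_low_rank: "R_filt X k \<subseteq> low_rank (Suc k)"
  unfolding R_filt_def
proof (rule ratfun.span_minimal)
  show "ratfun.subspace (low_rank (Suc k))"
    unfolding low_rank_def by (rule ratfun.subspace_span)
  have "Fract f (\<Prod>i<length X. lin_form (X ! i) ^ h i) \<in> low_rank (Suc k)"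
    if "vec.dim {X ! i |i. i < length X \<and> h i > 0} \<le> k" for f h
  proof -
    have "Fract f (\<Prod>i<length X. lin_form (X ! i) ^ h i)
        = to_fract f * (\<Prod>i<length X. inverse (to_fract (lin_form (X ! i))) ^ h i)"
      unfolding Fract_conv_to_fract divide_inverse to_fract_prod to_fract_power
      by (simp add: prod_inversef[symmetric] power_inverse comp_def)
    also have "\<dots> \<in> localized {X ! i |i. i < length X \<and> h i > 0}"
    proof (intro localized.mult localized.poly localized_prod)
      fix i
      assume "i \<in> {..<length X}"
      then show "inverse (to_fract (lin_form (X ! i))) ^ h i \<in> localized {X ! i |i. i < length X \<and> h i > 0}"
        by (cases "h i = 0") (auto intro!: localized_power localized.inverse localized_1)
    qed
    finally show ?thesis
      using that by (rule low_rank_base[OF _ le_imp_less_Suc])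
  qed
  then show "{Fract f (\<Prod>i<length X. lin_form (X ! i) ^ h i) |f h.
      vec.dim {X ! i |i. i < length X \<and> 0 < h i} \<le> k} \<subseteq> low_rank (Suc k)"
    by blast
qed

section \<open>Reciprocals of products of linear forms\<close>

definition recip :: "(nat \<Rightarrow> complex ^ 'n::{finite,linorder}) \<Rightarrow> nat set \<Rightarrow> 'n mpoly fract" where
  "recip x b = inverse (to_fract (\<Prod>i\<in>b. lin_form (x i)))"

lemma recip_insert: "finite b \<Longrightarrow> i \<notin> b \<Longrightarrow> recip x (insert i b) = inverse (to_fract (lin_form (x i))) * recip x b"
  by (simp add: recip_def)

lemma inv_d_eq_recip: "inv_d X b = recip ((!) X) b"
  by (simp add: inv_d_def recip_def Fract_conv_to_fract divide_inverse)

lemma recip_localized: "recip x b \<in> localized (x ` b)"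
  unfolding recip_def to_fract_prod prod_inversef[symmetric, unfolded comp_def]
  by (intro localized_prod localized.inverse) simp

text \<open>A vector of \<open>b\<close> cancels its own pole, leaving fewer than
  \<open>card b\<close> poles, and the vectors with the claimed property form a subspace. For a
  basis this says that every vector annihilates the class of its reciprocal.\<close>

lemma lin_form_mult_recip_low_rank:
  assumes "finite b" "a \<in> vec.span (x ` b)" "\<And>i. i \<in> b \<Longrightarrow> x i \<noteq> 0"
  shows "to_fract (lin_form a) * recip x b \<in> low_rank (card b)"
proof -
  have "vec.span (x ` b) \<subseteq> {a. to_fract (lin_form a) * recip x b \<in> low_rank (card b)}"
  proof (rule vec.span_minimal)
    show "x ` b \<subseteq> {a. to_fract (lin_form a) * recip x b \<in> low_rank (card b)}"
    proof clarify
      fix i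
      assume i: "i \<in> b"
      have "recip x b = inverse (to_fract (lin_form (x i))) * recip x (b - {i})"
        using recip_insert[of "b - {i}" i x] i assms(1) by (simp add: insert_absorb)
      then have "to_fract (lin_form (x i)) * recip x b = recip x (b - {i})"
        using assms(3)[OF i] by (simp add: mult.assoc[symmetric])
      moreover have "vec.dim (x ` (b - {i})) \<le> card (x ` (b - {i}))"
        using assms(1) by (intro vec.dim_le_card') simp
      moreover have "card (x ` (b - {i})) \<le> card (b - {i})"
        using assms(1) by (intro card_image_le) simp
      moreover have "card (b - {i}) < card b"
        using i assms(1) by (rule card_Diff1_less[rotated])
      ultimately show "to_fract (lin_form (x i)) * recip x b \<in> low_rank (card b)"
        by (metis low_rank_base recip_localized order.strict_trans1)
    qed
    show "vec.subspace {a. to_fract (lin_form a) * recip x b \<in> low_rank (card b)}"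
      unfolding vec.subspace_def
      by (auto simp: lin_form_add lin_form_scale distrib_right mult.assoc low_rank_0
          intro: low_rank_add low_rank_mult_poly)
  qed
  with assms(2) show ?thesis by auto
qed

text \<open>Moving one linear form past the operator gives minus the operator of the derived symbol,
  plus a term in which the form hits \<open>u\<close>; that term has low rank by assumption. Each
  factor thus contributes one sign.\<close>

lemma prod_lin_form_mult_poly_diffop:
  assumes "finite Y" "\<And>i. i \<in> Y \<Longrightarrow> to_fract (lin_form (x i)) * u \<in> low_rank k"
  shows "to_fract (\<Prod>i\<in>Y. lin_form (x i)) * poly_diffop p u
     - rat_scale ((- 1) ^ card Y) (poly_diffop (dd x Y p) u) \<in> low_rank k"
  using assms
proof (induction Y rule: finite_induct)
  case empty
  then show ?case by (simp add: low_rank_0)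
next
  case (insert i Y)
  let ?a = "to_fract (lin_form (x i))" and ?s = "(- 1) ^ card Y :: complex"
  let ?P = "to_fract (\<Prod>i\<in>Y. lin_form (x i)) * poly_diffop p u"
  have 1: "?P - rat_scale ?s (poly_diffop (dd x Y p) u) \<in> low_rank k" (is "?r \<in> _")
    using insert by simp
  have "?a * ?P = ?a * ?r + rat_scale ?s (?a * poly_diffop (dd x Y p) u)"
    by (simp add: rat_scale_eq algebra_simps)
  also have "?a * poly_diffop (dd x Y p) u
      = poly_diffop (dd x Y p) (?a * u) - poly_diffop (dd x (insert i Y) p) u"
    using insert(1,2) by (simp add: mult_lin_form_poly_diffop dd_insert)
  finally have "?a * ?P - rat_scale ((- 1) ^ card (insert i Y)) (poly_diffop (dd x (insert i Y) p) u)
      = ?a * ?r + rat_scale ?s (poly_diffop (dd x Y p) (?a * u))"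
    using insert(1,2) by (simp add: ratfun.scale_right_diff_distrib)
  moreover have "\<dots> \<in> low_rank k"
    by (rule low_rank_add[OF low_rank_mult_poly[OF 1] low_rank_scale[OF low_rank_poly_diffop]])
      (rule insert(4)[OF insertI1])
  ultimately show ?case
    using insert(1,2) by (simp add: mult.assoc)
qed

section \<open>Residues\<close>

text \<open>Evaluation of polynomials as a ring homomorphism, given by a homomorphism
  \<open>\<kappa>\<close> on scalars and values \<open>y\<close> for the variables. The homomorphism
  laws are proved once for an abstract target ring.\<close>

locale mp_evaluation =
  fixes \<kappa> :: "complex \<Rightarrow> 'r::comm_ring_1" and y :: "'n::finite \<Rightarrow> 'r"
  assumes \<kappa>_0: "\<kappa> 0 = 0" and \<kappa>_1: "\<kappa> 1 = 1"
    and \<kappa>_add: "\<kappa> (c + d) = \<kappa> c + \<kappa> d" and \<kappa>_mult: "\<kappa> (c * d) = \<kappa> c * \<kappa> d"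
begin

definition eval_mp :: "'n mpoly \<Rightarrow> 'r" where
  "eval_mp p = (\<Sum>m\<in>Poly_Mapping.keys p.
     \<kappa> (Poly_Mapping.lookup p m) * (\<Prod>j\<in>UNIV. y j ^ Poly_Mapping.lookup m j))"

lemma superset:
  assumes "finite A" "Poly_Mapping.keys p \<subseteq> A"
  shows "eval_mp p = (\<Sum>m\<in>A. \<kappa> (Poly_Mapping.lookup p m) * (\<Prod>j\<in>UNIV. y j ^ Poly_Mapping.lookup m j))"
  unfolding eval_mp_def
  by (rule sum.mono_neutral_left) (use assms in \<open>auto simp: in_keys_iff \<kappa>_0\<close>)

lemma single: "eval_mp (Poly_Mapping.single m c) = \<kappa> c * (\<Prod>j\<in>UNIV. y j ^ Poly_Mapping.lookup m j)"
  by (subst superset[of "{m}"]) auto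

lemma add: "eval_mp (p + q) = eval_mp p + eval_mp q"
proof -
  let ?A = "Poly_Mapping.keys p \<union> Poly_Mapping.keys q"
  have "Poly_Mapping.keys (p + q) \<subseteq> ?A"
    by (rule Poly_Mapping.keys_add)
  then show ?thesis
    by (simp add: superset[where A = ?A] lookup_add \<kappa>_add distrib_right sum.distrib)
qed

lemma zero: "eval_mp 0 = 0"
  by (simp add: eval_mp_def)

lemma sum: "eval_mp (sum f A) = (\<Sum>x\<in>A. eval_mp (f x))"
  by (induction A rule: infinite_finite_induct) (simp_all add: add zero)

lemma mult: "eval_mp (p * q) = eval_mp p * eval_mp q"
proof -
  have "eval_mp ((\<Sum>m\<in>A. Poly_Mapping.single m (f m)) * (\<Sum>m\<in>B. Poly_Mapping.single m (g m)))
     = eval_mp (\<Sum>m\<in>A. Poly_Mapping.single m (f m)) * eval_mp (\<Sum>m\<in>B. Poly_Mapping.single m (g m))" for A B f g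
    by (simp add: sum_product sum single mult_single \<kappa>_mult lookup_add power_add prod.distrib mult_ac)
  from this[of "Poly_Mapping.lookup p" "Poly_Mapping.keys p" "Poly_Mapping.lookup q" "Poly_Mapping.keys q"]
  show ?thesis
    by (simp only: mp_sum_single[symmetric])
qed

lemma const: "eval_mp (mp_const c) = \<kappa> c"
  by (simp add: mp_const_def single)

lemma one: "eval_mp 1 = 1"
  using const[of 1] by (simp add: mp_const_simps \<kappa>_1)

lemma var: "eval_mp (mp_var i) = y i"
proof -
  have "(\<Prod>j\<in>UNIV. y j ^ (if i = j then Suc 0 else 0)) = (\<Prod>j\<in>UNIV. if i = j then y j else 1)"
    by (intro prod.cong) auto
  then show ?thesis
    by (simp add: mp_var_def single \<kappa>_1 lookup_single when_def)
qed

lemma prod: "eval_mp (prod f A) = (\<Prod>x\<in>A. eval_mp (f x))"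
  by (induction A rule: infinite_finite_induct) (simp_all add: mult one)

end

lemma monomial_prod:
  "Poly_Mapping.single m c = mp_const c * (\<Prod>j\<in>UNIV. mp_var j ^ Poly_Mapping.lookup m j)"
  for m :: "'n::finite \<Rightarrow>\<^sub>0 nat"
proof -
  have pow: "mp_var j ^ k = Poly_Mapping.single (Poly_Mapping.single j k) 1" for j :: 'n and k
    by (induction k) (simp_all add: mp_var_def mult_single single_add[symmetric])
  have prod: "(\<Prod>j\<in>A. Poly_Mapping.single (g j) 1) = (Poly_Mapping.single (sum g A) 1 :: 'n mpoly)"
    for A :: "'n set" and g
    by (induction A rule: infinite_finite_induct) (simp_all add: mult_single)
  have "(\<Sum>j\<in>UNIV. Poly_Mapping.single j (Poly_Mapping.lookup m j)) = m"
    by (rule poly_mapping_eqI) (simp add: lookup_sum lookup_single when_def)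
  then show ?thesis
    by (simp add: pow prod mp_const_def mult_single)
qed

text \<open>Reduces claims compatible with sums and products to constants and variables.\<close>

lemma mp_sum_monomials:
  "(p :: 'n::finite mpoly) = (\<Sum>m\<in>Poly_Mapping.keys p.
     mp_const (Poly_Mapping.lookup p m) * (\<Prod>j\<in>UNIV. mp_var j ^ Poly_Mapping.lookup m j))"
  using mp_sum_single[of p] by (simp only: monomial_prod)

text \<open>
  Splitting off the direction \<open>a\<close>: a vector \<open>v\<close> becomes the linear polynomial with constant term
  \<open>proj l a v\<close> in the variable \<open>t = a\<close>.  Expanding fractions as Laurent series in \<open>t\<close>
  gives the residue along the hyperplane \<open>a = 0\<close>.
\<close>

interpretation split: mp_evaluation "\<lambda>c. [:to_fract (mp_const c):]"
    "\<lambda>j. [:to_fract (lin_form (proj l a (axis j 1))), to_fract (mp_const (axis j 1 $ l / a $ l)):]"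
    for l :: "'n::{finite,linorder}" and a :: "complex ^ 'n::{finite,linorder}"
  by unfold_locales (simp_all add: mp_const_simps one_pCons)

text \<open>Both sides are linear in \<open>v\<close> and agree on the standard basis, whose images
  define the splitting.\<close>

lemma split_lin_form:
  "split.eval_mp l a (lin_form v) = [:to_fract (lin_form (proj l a v)), to_fract (mp_const (v $ l / a $ l)):]"
proof -
  let ?f = "\<lambda>v. split.eval_mp l a (lin_form v)"
  let ?g = "\<lambda>v. [:to_fract (lin_form (proj l a v)), to_fract (mp_const (v $ l / a $ l)):]"
  have "?f (\<Sum>j\<in>S. v $ j *s axis j 1) = ?g (\<Sum>j\<in>S. v $ j *s axis j 1)" for S
  proof (induction S rule: infinite_finite_induct)
    case (insert j S)
    have "?f (v $ j *s axis j 1) = ?g (v $ j *s axis j 1)"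
      by (simp add: lin_form_scale split.mult split.const lin_form_axis split.var proj_scale mp_const_simps
          flip: times_divide_eq_right)
    with insert show ?case
      by (simp add: lin_form_add split.add proj_add mp_const_simps add_divide_distrib)
  qed (simp_all add: split.zero)
  from this[of UNIV] show ?thesis
    by (simp only: basis_expansion)
qed

text \<open>Substituting \<open>a\<close> for \<open>t\<close> undoes the splitting, since
  \<open>proj_decomp\<close> gives this for every variable. Hence the splitting is
  injective.\<close>

lemma poly_split:
  assumes "a $ l \<noteq> 0"
  shows "poly (split.eval_mp l a p) (to_fract (lin_form a)) = to_fract p"
proof -
  have const: "poly (split.eval_mp l a (mp_const c)) (to_fract (lin_form a)) = to_fract (mp_const c)" for c
    by (simp add: split.const)
  have var: "poly (split.eval_mp l a (mp_var j)) (to_fract (lin_form a)) = to_fract (mp_var j)" for j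
  proof -
    have "axis j 1 = proj l a (axis j 1) + (axis j 1 $ l / a $ l) *s a"
      by (rule proj_decomp)
    then have var: "mp_var j = lin_form (proj l a (axis j 1) + (axis j 1 $ l / a $ l) *s a)"
      by (simp flip: lin_form_axis)
    have "poly (split.eval_mp l a (mp_var j)) (to_fract (lin_form a))
        = to_fract (lin_form (proj l a (axis j 1))) + to_fract (lin_form a) * to_fract (mp_const (axis j 1 $ l / a $ l))"
      by (simp add: split.var)
    also have "\<dots> = to_fract (mp_var j)"
      unfolding var by (simp add: lin_form_add lin_form_scale mult.commute)
    finally show ?thesis .
  qed
  have "poly (split.eval_mp l a (\<Sum>m\<in>K. mp_const (f m) * (\<Prod>j\<in>UNIV. mp_var j ^ g m j))) (to_fract (lin_form a))
     = to_fract (\<Sum>m\<in>K. mp_const (f m) * (\<Prod>j\<in>UNIV. mp_var j ^ g m j))" for K f and g :: "_ \<Rightarrow> _ \<Rightarrow> nat"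
  proof -
    have pow: "split.eval_mp l a (q ^ k) = split.eval_mp l a q ^ k" for q k
      by (induction k) (simp_all add: split.mult split.one)
    show ?thesis
      by (simp add: var const split.sum split.mult split.prod pow poly_sum poly_prod to_fract_sum to_fract_prod to_fract_power)
  qed
  from this[of "Poly_Mapping.lookup p" "Poly_Mapping.lookup" "Poly_Mapping.keys p"] show ?thesis
    by (simp only: mp_sum_monomials[symmetric])
qed

section \<open>Laurent expansion along a hyperplane\<close>

definition laurent_mp :: "'n::{finite,linorder} \<Rightarrow> complex ^ 'n::{finite,linorder} \<Rightarrow> 'n mpoly \<Rightarrow> 'n mpoly fract fls" where
  "laurent_mp l a p = fps_to_fls (fps_of_poly (split.eval_mp l a p))"

lemma laurent_mp_add: "laurent_mp l a (p + q) = laurent_mp l a p + laurent_mp l a q"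
  and laurent_mp_mult: "laurent_mp l a (p * q) = laurent_mp l a p * laurent_mp l a q"
  and laurent_mp_1: "laurent_mp l a 1 = 1"
  and laurent_mp_0: "laurent_mp l a 0 = 0"
  by (simp_all add: laurent_mp_def split.add split.mult split.one split.zero
      fps_of_poly_add fps_of_poly_mult fls_times_fps_to_fls)

lemma laurent_mp_eq_0_iff:
  assumes "a $ l \<noteq> 0"
  shows "laurent_mp l a p = 0 \<longleftrightarrow> p = 0"
proof
  assume "laurent_mp l a p = 0"
  then have "split.eval_mp l a p = 0"
    using fps_of_poly_eq_iff[of "split.eval_mp l a p" 0] by (simp add: laurent_mp_def)
  then show "p = 0"
    using poly_split[OF assms, of p] by simp
qed (simp add: laurent_mp_0)

definition laurent :: "'n::{finite,linorder} \<Rightarrow> complex ^ 'n::{finite,linorder} \<Rightarrow> 'n mpoly fract \<Rightarrow> 'n mpoly fract fls" where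
  "laurent l a u = (let r = SOME r. snd r \<noteq> 0 \<and> u = Fract (fst r) (snd r)
     in laurent_mp l a (fst r) / laurent_mp l a (snd r))"

text \<open>The representative chosen in \<open>laurent\<close> is irrelevant: cross-multiplied
  numerators agree, the expansion of polynomials is multiplicative, and nonzero denominators have
  nonzero expansions.\<close>

lemma laurent_Fract:
  assumes "a $ l \<noteq> 0" "g \<noteq> 0"
  shows "laurent l a (Fract f g) = laurent_mp l a f / laurent_mp l a g"
proof -
  define r where "r = (SOME r. snd r \<noteq> 0 \<and> Fract f g = Fract (fst r) (snd r))"
  have r: "snd r \<noteq> 0 \<and> Fract f g = Fract (fst r) (snd r)"
    unfolding r_def by (rule someI[of _ "(f, g)"]) (use assms in simp)
  then have "f * snd r = fst r * g"
    using assms(2) eq_fract(1)[of g "snd r" f "fst r"] by simp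
  then have "laurent_mp l a f * laurent_mp l a (snd r) = laurent_mp l a (fst r) * laurent_mp l a g"
    by (simp flip: laurent_mp_mult)
  moreover have "laurent l a (Fract f g) = laurent_mp l a (fst r) / laurent_mp l a (snd r)"
    by (simp only: laurent_def r_def Let_def)
  ultimately show ?thesis
    using assms r by (simp add: frac_eq_eq laurent_mp_eq_0_iff)
qed

context
  fixes l :: "'n::{finite,linorder}" and a :: "complex ^ 'n::{finite,linorder}"
  assumes a: "a $ l \<noteq> 0"
begin

lemma laurent_to_fract: "laurent l a (to_fract f) = laurent_mp l a f"
  using laurent_Fract[OF a, of 1 f] by (simp add: to_fract_def laurent_mp_1)

lemma laurent_add: "laurent l a (u + v) = laurent l a u + laurent l a v"
proof (cases u, cases v)
  fix f g h k
  assume "u = Fract f g" "g \<noteq> 0" "v = Fract h k" "k \<noteq> 0"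
  then show ?thesis
    by (simp add: laurent_Fract[OF a] laurent_mp_add laurent_mp_mult laurent_mp_eq_0_iff[OF a] add_frac_eq)
qed

lemma laurent_mult: "laurent l a (u * v) = laurent l a u * laurent l a v"
proof (cases u, cases v)
  fix f g h k
  assume "u = Fract f g" "g \<noteq> 0" "v = Fract h k" "k \<noteq> 0"
  then show ?thesis
    by (simp add: laurent_Fract[OF a] laurent_mp_mult)
qed

lemma laurent_inverse_to_fract: "laurent l a (inverse (to_fract f)) = inverse (laurent_mp l a f)"
proof (cases "f = 0")
  case True
  then show ?thesis
    using laurent_to_fract[of 0] by (simp add: laurent_mp_0)
next
  case False
  then have "inverse (to_fract f) = Fract 1 f"
    by (simp add: to_fract_def)
  with False show ?thesis
    by (simp add: laurent_Fract[OF a] laurent_mp_1 divide_inverse)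
qed

lemma laurent_mp_const: "laurent_mp l a (mp_const c) = fls_const (to_fract (mp_const c))"
  by (simp add: laurent_mp_def split.const fps_of_poly_const)

lemma laurent_mp_lin_form_parallel:
  assumes "proj l a v = 0"
  shows "laurent_mp l a (lin_form v) = fls_const (to_fract (mp_const (v $ l / a $ l))) * fls_X"
proof -
  have "fps_of_poly [:0, c:] = fps_const c * fps_X" for c :: "'n mpoly fract"
    by (simp add: fps_of_poly_pCons)
  then show ?thesis
    by (simp only: laurent_mp_def split_lin_form assms lin_form_0 to_fract_0 fls_times_fps_to_fls
        fps_const_to_fls fps_X_to_fls)
qed

lemma laurent_mp_lin_form:
  "laurent_mp l a (lin_form v) = fps_to_fls (fps_of_poly
     [:to_fract (lin_form (proj l a v)), to_fract (mp_const (v $ l / a $ l)):])"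
  by (simp add: laurent_mp_def split_lin_form)

text \<open>The constant term is nonzero, so the inverse is already a power series, without negative
  powers of \<open>t\<close>.\<close>

lemma inverse_laurent_mp_lin_form:
  assumes "proj l a v \<noteq> 0"
  shows "inverse (laurent_mp l a (lin_form v)) = fps_to_fls (inverse (fps_of_poly
     [:to_fract (lin_form (proj l a v)), to_fract (mp_const (v $ l / a $ l)):]))"
  unfolding laurent_mp_lin_form
  by (rule fls_inverse_fps_to_fls) (rule subdegree_eq_0, use assms in simp)

lemma laurent_mult_coeffs:
  fixes f g :: "'n mpoly fract fls"
  assumes "\<And>n. fls_nth f n \<in> localized T" "\<And>n. fls_nth g n \<in> localized T"
  shows "fls_nth (f * g) n \<in> localized T"
  unfolding fls_times_nth(1) by (intro localized_sum localized.mult assms)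

text \<open>The coefficients are polynomials, hence free of poles for every
  \<open>T\<close>.\<close>

lemma laurent_mp_coeffs: "fls_nth (laurent_mp l a p) n \<in> localized T"
proof -
  have const: "fls_nth (laurent_mp l a (mp_const c)) n \<in> localized T" for c n
    by (simp add: laurent_mp_const localized_0 localized.poly)
  have var: "fls_nth (laurent_mp l a (mp_var j)) n \<in> localized T" for j n
  proof -
    have "coeff [:to_fract f, to_fract g:] k \<in> localized T" for f g k
      by (simp add: coeff_pCons localized_0 localized.poly split: nat.split)
    then show ?thesis
      by (simp add: laurent_mp_lin_form localized_0 flip: lin_form_axis del: coeff_pCons)
  qed
  have pow: "fls_nth (laurent_mp l a (mp_var j ^ k)) n \<in> localized T" for j k n
    by (induction k arbitrary: n) (simp_all add: laurent_mp_1 laurent_mp_mult localized_0 localized_1 laurent_mult_coeffs var)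
  have prod: "fls_nth (laurent_mp l a (\<Prod>j\<in>A. mp_var j ^ g j)) n \<in> localized T" for A g n
    by (induction A arbitrary: n rule: infinite_finite_induct)
      (simp_all add: laurent_mp_1 laurent_mp_mult localized_0 localized_1 laurent_mult_coeffs pow)
  have "fls_nth (laurent_mp l a (\<Sum>m\<in>K. mp_const (f m) * (\<Prod>j\<in>UNIV. mp_var j ^ g m j))) n \<in> localized T"
    for K f and g :: "_ \<Rightarrow> _ \<Rightarrow> nat" and n
    by (induction K arbitrary: n rule: infinite_finite_induct)
      (simp_all add: laurent_mp_0 laurent_mp_mult laurent_mp_add localized_0 laurent_mult_coeffs const prod localized.add)
  from this[of "Poly_Mapping.lookup p" "Poly_Mapping.lookup" "Poly_Mapping.keys p"] show ?thesis
    by (simp only: mp_sum_monomials[symmetric])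
qed

text \<open>A form parallel to \<open>a\<close> inverts to a scalar times a power of
  \<open>t\<close>. Any other form inverts to a geometric series whose coefficients have only the
  projected form as a pole.\<close>

lemma laurent_coeffs: "u \<in> localized T \<Longrightarrow> fls_nth (laurent l a u) n \<in> localized (proj l a ` T)"
proof (induction arbitrary: n rule: localized.induct)
  case (poly f)
  then show ?case by (simp add: laurent_to_fract laurent_mp_coeffs)
next
  case (inverse t)
  show ?case
  proof (cases "proj l a t = 0")
    case True
    have "inverse (laurent_mp l a (lin_form t)) = fls_const (inverse (to_fract (mp_const (t $ l / a $ l)))) * fls_X_inv"
      by (simp add: laurent_mp_lin_form_parallel[OF True] fls_inverse_const fls_inverse_X)
    moreover have "inverse (to_fract (mp_const c)) = (to_fract (mp_const (inverse c)) :: 'n mpoly fract)" for c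
    proof (cases "c = 0")
      case False
      have "to_fract (mp_const c) * to_fract (mp_const (inverse c)) = (1 :: 'n mpoly fract)"
        unfolding to_fract_mult[symmetric] mp_const_simps(2)[symmetric] using False by (simp add: mp_const_simps)
      then show ?thesis by (rule inverse_unique)
    qed simp
    ultimately show ?thesis
      by (simp add: laurent_inverse_to_fract localized_0 localized.poly)
  next
    case False
    define p0 where "p0 = to_fract (lin_form (proj l a t))"
    define c :: "'n mpoly" where "c = mp_const (t $ l / a $ l)"
    define g where "g = inverse (fps_of_poly [:p0, to_fract c:])"
    have p0: "p0 \<noteq> 0" using False by (simp add: p0_def)
    have p0_inv: "inverse p0 \<in> localized (proj l a ` T)"
      unfolding p0_def using inverse by (intro localized.inverse) simp
    have eq: "(fps_const p0 + fps_const (to_fract c) * fps_X) * g = 1"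
    proof -
      have "fps_of_poly [:p0, to_fract c:] * g = 1"
        unfolding g_def by (rule inverse_mult_eq_1') (simp add: p0)
      then show ?thesis by (simp add: fps_of_poly_pCons)
    qed
    have "fps_nth g k \<in> localized (proj l a ` T)" for k
    proof (induction k)
      case 0
      then show ?case by (simp add: g_def p0_inv)
    next
      case (Suc k)
      \<comment> \<open>Comparing coefficients in \<open>eq\<close> gives a recursion that divides
        only by \<open>p0\<close>.\<close>
      have "fps_nth ((fps_const p0 + fps_const (to_fract c) * fps_X) * g) (Suc k) = 0"
        unfolding eq by simp
      then have "p0 * fps_nth g (Suc k) + to_fract c * fps_nth g k = 0"
        by (simp add: distrib_right mult.assoc)
      then have "p0 * fps_nth g (Suc k) = - (to_fract c * fps_nth g k)"
        by (simp add: add_eq_0_iff2)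
      then have "fps_nth g (Suc k) = inverse p0 * - (to_fract c * fps_nth g k)"
        using p0 by (metis mult.assoc left_inverse mult_1_left)
      then show ?case
        using Suc by (auto intro!: localized.mult localized_uminus p0_inv localized.poly)
    qed
    then have "fls_nth (fps_to_fls g) n \<in> localized (proj l a ` T)"
      by (simp add: localized_0)
    then show ?thesis
      by (simp add: laurent_inverse_to_fract inverse_laurent_mp_lin_form[OF False] g_def p0_def c_def)
  qed
next
  case (add u v)
  then show ?case by (simp add: laurent_add localized.add)
next
  case (mult u v)
  then show ?case by (simp add: laurent_mult laurent_mult_coeffs)
qed

text \<open>Without a pole along the hyperplane all generators expand as power series. Zero vectors
  in \<open>T\<close> are harmless, as their inverses are zero.\<close>

lemma laurent_regular:
  assumes "u \<in> localized T" "\<And>t. t \<in> T \<Longrightarrow> t \<noteq> 0 \<Longrightarrow> proj l a t \<noteq> 0"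
  shows "\<exists>h. laurent l a u = fps_to_fls h"
  using assms(1)
proof (induction rule: localized.induct)
  case (poly f)
  then show ?case by (auto simp: laurent_to_fract laurent_mp_def)
next
  case (inverse t)
  show ?case
  proof (cases "t = 0")
    case True
    then show ?thesis
      by (intro exI[of _ 0]) (simp add: laurent_inverse_to_fract laurent_mp_0 del: inverse_zero to_fract_0)
  next
    case False
    then show ?thesis
      using inverse assms(2) by (auto simp: laurent_inverse_to_fract inverse_laurent_mp_lin_form)
  qed
next
  case (add u v)
  then show ?case by (auto simp: laurent_add fps_to_fls_plus[symmetric] simp del: fps_to_fls_plus)
next
  case (mult u v)
  then show ?case by (auto simp: laurent_mult fls_times_fps_to_fls[symmetric])
qed

section \<open>The residue along a hyperplane\<close>

definition residue :: "'n mpoly fract \<Rightarrow> 'n mpoly fract" where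
  "residue u = fls_nth (laurent l a u) (- 1)"

lemma rat_linear_residue: "rat_linear residue"
  by (simp add: rat_linear_def residue_def laurent_add rat_scale_eq laurent_mult laurent_to_fract laurent_mp_const)

text \<open>If \<open>T\<close> contains a nonzero multiple of \<open>a\<close>, projecting
  \<open>T\<close> lowers its dimension by one. Otherwise the dimension need not drop, but the
  expansion is regular and the residue is zero.\<close>

lemma residue_low_rank:
  assumes "u \<in> low_rank k"
  shows "residue u \<in> low_rank (k - 1)"
proof (rule low_rank_induct[OF rat_linear_residue assms])
  fix T and v :: "'n mpoly fract"
  assume T: "vec.dim T < k" and v: "v \<in> localized T"
  show "residue v \<in> low_rank (k - 1)"
  proof (cases "\<exists>t\<in>T. t \<noteq> 0 \<and> proj l a t = 0")
    case True
    then obtain t where t: "t \<in> T" "t \<noteq> 0" "proj l a t = 0" by blast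
    define c where "c = t $ l / a $ l"
    have tc: "t = c *s a"
      using proj_decomp[of t l a] t(3) by (simp add: c_def)
    with t(2) have "c \<noteq> 0" by auto
    then have "a = inverse c *s t"
      unfolding tc by simp
    then have "a \<in> vec.span T"
      using t(1) by (metis vec.span_base vec.span_scale)
    then have "vec.dim T = Suc (vec.dim (proj l a ` T))"
      using dim_insert_proj[OF a, of T] by (simp add: vec.dim_insert)
    then show ?thesis
      unfolding residue_def using T by (intro low_rank_base[OF laurent_coeffs[OF v]]) simp
  next
    case False
    then obtain h where "laurent l a v = fps_to_fls h"
      using laurent_regular[OF v] by blast
    then show ?thesis
      by (simp add: residue_def low_rank_0)
  qed
qed

text \<open>The constant term of the expansion is the restriction to the hyperplane, obtained by
  projecting each factor.\<close>

lemma laurent_recip: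
  assumes "finite b" "\<And>i. i \<in> b \<Longrightarrow> proj l a (x i) \<noteq> 0"
  shows "\<exists>h. laurent l a (recip x b) = fps_to_fls h \<and> fps_nth h 0 = recip (proj l a \<circ> x) b"
  using assms
proof (induction b rule: finite_induct)
  case empty
  have "laurent l a 1 = 1"
    using laurent_to_fract[of 1] by (simp add: laurent_mp_1)
  then show ?case
    by (intro exI[of _ 1]) (simp add: recip_def)
next
  case (insert i b)
  obtain h where h: "laurent l a (recip x b) = fps_to_fls h" "fps_nth h 0 = recip (proj l a \<circ> x) b"
    using insert.IH insert.prems by blast
  define g where "g = inverse (fps_of_poly
    [:to_fract (lin_form (proj l a (x i))), to_fract (mp_const (x i $ l / a $ l)):])"
  have "laurent l a (inverse (to_fract (lin_form (x i)))) = fps_to_fls g"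
    using insert(4)[of i] by (simp add: laurent_inverse_to_fract inverse_laurent_mp_lin_form g_def)
  then have "laurent l a (recip x (insert i b)) = fps_to_fls (g * h)"
    using insert(1,2) h by (simp add: recip_insert laurent_mult fls_times_fps_to_fls)
  moreover have "fps_nth (g * h) 0 = recip (proj l a \<circ> x) (insert i b)"
    using insert(1,2) h by (simp add: recip_insert g_def)
  ultimately show ?case by blast
qed

text \<open>The factor for \<open>a\<close> itself contributes the inverse of \<open>t\<close>,
  which shifts the constant term of the remaining product into the position of the residue.\<close>

lemma residue_recip:
  assumes "finite b" "\<And>i. i \<in> b \<Longrightarrow> proj l a (x i) \<noteq> 0"
  shows "residue (recip x b) = 0"
    and "m \<notin> b \<Longrightarrow> x m = a \<Longrightarrow> residue (recip x (insert m b)) = recip (proj l a \<circ> x) b"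
proof -
  obtain h where h: "laurent l a (recip x b) = fps_to_fls h" "fps_nth h 0 = recip (proj l a \<circ> x) b"
    using laurent_recip[OF assms(1), of x] assms(2) by blast
  then show "residue (recip x b) = 0"
    by (simp add: residue_def)
  assume m: "m \<notin> b" "x m = a"
  have "inverse (laurent_mp l a (lin_form a)) = fls_X_inv"
    using a by (simp add: laurent_mp_lin_form_parallel proj_self mp_const_simps fls_inverse_X)
  then have "laurent l a (recip x (insert m b)) = fls_X_inv * fps_to_fls h"
    using m h assms(1) by (simp add: recip_insert laurent_mult laurent_inverse_to_fract)
  then show "residue (recip x (insert m b)) = recip (proj l a \<circ> x) b"
    using h by (simp add: residue_def fls_X_inv_times_conv_shift)
qed

end

section \<open>Linear independence of the reciprocals of no broken bases\<close>

lemma finite_nb: "finite I \<Longrightarrow> finite {b. nb x I b}"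
  by (rule finite_subset[of _ "Pow I"]) (auto simp: nb_def)

lemma recip_independent:
  fixes x :: "nat \<Rightarrow> complex ^ 'n::{finite,linorder}"
  assumes "finite I" "\<And>i. i \<in> I \<Longrightarrow> x i \<noteq> 0"
    and "(\<Sum>b | nb x I b. rat_scale (c b) (recip x b)) \<in> low_rank (vec.dim (x ` I))"
    and "nb x I b"
  shows "c b = 0"
  using assms
proof (induction "card I" arbitrary: I x c b rule: less_induct)
  case less
  note fin = less.prems(1) and nz = less.prems(2) and low = less.prems(3) and b = less.prems(4)
  show ?case
  proof (cases "I = {}")
    case True
    have "{b. nb x I b} = {{}}" and b: "b = {}"
      using True b by (auto simp: nb_def vec.independent_empty)
    with low True have "rat_scale (c {}) (1 :: 'n mpoly fract) \<in> low_rank 0"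
      by (simp add: recip_def)
    \<comment> \<open>No dimension is below zero, so \<open>low_rank 0\<close> is the span of the
      empty set.\<close>
    then have "rat_scale (c {}) (1 :: 'n mpoly fract) = 0"
      by (simp add: low_rank_def)
    then show ?thesis
      by (simp add: b)
  next
    case False
    define m where "m = Max I"
    define J where "J = I - {m}"
    have mI: "m \<in> I"
      unfolding m_def by (rule Max_in[OF fin False])
    then have I: "I = insert m J" and mJ: "m \<notin> J" and finJ: "finite J"
      using fin by (auto simp: J_def)
    have lt: "i < m" if "i \<in> J" for i
      using that fin by (auto simp: J_def m_def order.strict_iff_order)
    have cI: "card J < card I"
      using I mJ finJ by simp
    obtain l where al: "x m $ l \<noteq> 0"
      using nz[OF mI] by (auto simp: vec_eq_iff)
    define P where "P = proj l (x m)"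
    \<comment> \<open>The existence of one no broken basis through \<open>m\<close> already excludes
      vectors parallel to \<open>x m\<close>, which is what the contraction argument needs.\<close>
    have with_m: "c b = 0" if b: "nb x I b" and mb: "m \<in> b" for b
    proof -
      have np: "P (x i) \<noteq> 0" if "i \<in> J" for i
        unfolding P_def
        by (rule nb_last_not_parallel[of x m J b]) (use b mb lt that al nz I in auto)
      have iff: "nb x I (insert m b') \<longleftrightarrow> nb (P \<circ> x) J b'" if "b' \<subseteq> J" for b'
        unfolding I P_def by (rule nb_contraction) (use finJ lt al np that in \<open>auto simp: P_def\<close>)
      have sub: "b' \<subseteq> J" if "nb (P \<circ> x) J b'" for b'
        using that by (simp add: nb_def)
      have subI: "b' \<subseteq> insert m J" if "nb x I b'" for b'
        using that I by (simp add: nb_def)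
      have split_b: "\<exists>b'\<subseteq>J. b = insert m b'" if "nb x I b" "m \<in> b" for b
        using subI[OF that(1)] that(2) by (intro exI[of _ "b - {m}"]) auto
      let ?res = "residue l (x m)"
      have lin: "rat_linear ?res" by (rule rat_linear_residue[OF al])
      \<comment> \<open>The residue kills the bases avoiding \<open>m\<close>; the others correspond
        bijectively to the no broken bases of the contraction.\<close>
      have "(\<Sum>b | nb x I b. rat_scale (c b) (?res (recip x b)))
          = (\<Sum>b\<in>insert m ` {b'. nb (P \<circ> x) J b'}. rat_scale (c b) (?res (recip x b)))"
      proof (rule sum.mono_neutral_right)
        show "finite {b. nb x I b}" by (rule finite_nb[OF fin])
        show "insert m ` {b'. nb (P \<circ> x) J b'} \<subseteq> {b. nb x I b}"
          using iff sub by blast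
        show "\<forall>b\<in>{b. nb x I b} - insert m ` {b'. nb (P \<circ> x) J b'}. rat_scale (c b) (?res (recip x b)) = 0"
        proof
          fix b
          assume b: "b \<in> {b. nb x I b} - insert m ` {b'. nb (P \<circ> x) J b'}"
          have "m \<notin> b"
          proof
            assume "m \<in> b"
            then obtain b' where b': "b' \<subseteq> J" "b = insert m b'"
              using split_b b by blast
            then have "nb (P \<circ> x) J b'"
              using b iff by simp
            with b b'(2) show False by simp
          qed
          then have "b \<subseteq> J" using b subI by blast
          then have "?res (recip x b) = 0"
            using finJ np by (intro residue_recip(1)[OF al]) (auto simp: P_def intro: finite_subset)
          then show "rat_scale (c b) (?res (recip x b)) = 0" by simp
        qed
      qed
      also have "\<dots> = (\<Sum>b' | nb (P \<circ> x) J b'. rat_scale (c (insert m b')) (?res (recip x (insert m b'))))"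
      proof (rule sum.reindex_cong[OF _ refl refl])
        show "inj_on (insert m) {b'. nb (P \<circ> x) J b'}"
          using sub mJ by (intro inj_onI) (metis insert_ident mem_Collect_eq subsetD)
      qed
      also have "\<dots> = (\<Sum>b' | nb (P \<circ> x) J b'. rat_scale (c (insert m b')) (recip (P \<circ> x) b'))"
      proof (rule sum.cong[OF refl])
        fix b'
        assume "b' \<in> {b'. nb (P \<circ> x) J b'}"
        then have "b' \<subseteq> J" using sub by simp
        then have "?res (recip x (insert m b')) = recip (P \<circ> x) b'"
          unfolding P_def using finJ np mJ
          by (intro residue_recip(2)[OF al]) (auto simp: P_def intro: finite_subset)
        then show "rat_scale (c (insert m b')) (?res (recip x (insert m b')))
            = rat_scale (c (insert m b')) (recip (P \<circ> x) b')" by simp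
      qed
      also have "(\<Sum>b | nb x I b. rat_scale (c b) (?res (recip x b))) = ?res (\<Sum>b | nb x I b. rat_scale (c b) (recip x b))"
        by (simp add: rat_linear_sum[OF lin] rat_linear_scale[OF lin])
      finally have eq: "(\<Sum>b' | nb (P \<circ> x) J b'. rat_scale (c (insert m b')) (recip (P \<circ> x) b'))
          = ?res (\<Sum>b | nb x I b. rat_scale (c b) (recip x b))" ..
      \<comment> \<open>The residue lowers the rank bound by one, exactly as contraction lowers the
        rank.\<close>
      have dim: "vec.dim (x ` I) - 1 = vec.dim ((P \<circ> x) ` J)"
        using dim_insert_proj[OF al, of "x ` J"] by (simp add: I P_def image_comp)
      have low': "(\<Sum>b' | nb (P \<circ> x) J b'. rat_scale (c (insert m b')) (recip (P \<circ> x) b'))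
          \<in> low_rank (vec.dim ((P \<circ> x) ` J))"
        unfolding eq dim[symmetric] by (rule residue_low_rank[OF al low])
      obtain b' where b': "b' \<subseteq> J" "b = insert m b'"
        using split_b[OF b mb] by blast
      then have "nb (P \<circ> x) J b'"
        using b iff by simp
      then have "c (insert m b') = 0"
        using np by (intro less.hyps[OF cI finJ _ low']) simp
      with b'(2) show ?thesis by simp
    qed
    show ?thesis
    proof (cases "m \<in> b")
      case True
      with b with_m show ?thesis by blast
    next
      case False
      then have bJ: "b \<subseteq> J" using b I by (auto simp: nb_def)
      have JI: "J \<subseteq> I" using I by blast
      have nbJ: "nb x J b" and sp: "vec.span (x ` J) = vec.span (x ` I)"
        using nb_deletion[OF b bJ JI] by auto
      have "nb x I b'" "m \<notin> b'" if "nb x J b'" for b'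
      proof -
        show "nb x I b'"
          unfolding I by (rule nb_insert_last[OF that]) (use sp I lt in auto)
        show "m \<notin> b'" using that mJ by (auto simp: nb_def)
      qed
      moreover have "nb x J b'" if "nb x I b'" "m \<notin> b'" for b'
        by (rule nb_deletion(1)[OF that(1) _ JI]) (use that I in \<open>auto simp: nb_def\<close>)
      ultimately have NB: "{b. nb x J b} = {b. nb x I b} - {b. m \<in> b}"
        by blast
      \<comment> \<open>The bases through \<open>m\<close> have coefficient zero by
        \<open>with_m\<close>, so the relation lives on the deletion.\<close>
      have "(\<Sum>b | nb x J b. rat_scale (c b) (recip x b)) = (\<Sum>b | nb x I b. rat_scale (c b) (recip x b))"
        unfolding NB
        by (rule sum.mono_neutral_left) (use finite_nb[OF fin] with_m in auto)
      then have "(\<Sum>b | nb x J b. rat_scale (c b) (recip x b)) \<in> low_rank (vec.dim (x ` J))"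
        using low vec.span_eq_dim[OF sp] by simp
      from less.hyps[OF cI finJ _ this nbJ] nz JI show ?thesis by blast
    qed
  qed
qed

section \<open>From lists to indexed families\<close>

lemma card_extracted_basis: "extracted_basis X b \<Longrightarrow> card b = CARD('n)"
  for X :: "(complex ^ 'n::finite) list"
proof -
  assume b: "extracted_basis X b"
  then have "card b = vec.dim ((!) X ` b)"
    by (simp add: extracted_basis_def card_image vec.dim_eq_card_independent)
  also have "\<dots> = vec.dim (vec.span ((!) X ` b))"
    by simp
  also have "\<dots> = CARD('n)"
    using b by (simp only: extracted_basis_def vec_dim_card)
  finally show ?thesis .
qed

text \<open>Each of the \<open>s\<close> elements of \<open>b\<close> breaks \<open>b\<close>, by
  taking the tail that starts with it. Hence exactly \<open>s\<close> breaking elements means that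
  none lies outside \<open>b\<close>.\<close>

lemma no_broken_bases_eq_nb:
  fixes X :: "(complex ^ 'n::finite) list"
  assumes "vec.span (set X) = UNIV"
  shows "no_broken_bases X = {b. nb ((!) X) {..<length X} b}"
proof -
  have set: "(!) X ` {..<length X} = set X"
    by (auto simp: in_set_conv_nth)
  have iff: "card {i. i < length X \<and> breaks X i b} = CARD('n)
      \<longleftrightarrow> (\<forall>i\<in>{..<length X} - b. \<forall>j\<in>b. i \<le> j \<longrightarrow> X ! i \<notin> vec.span ((!) X ` {k\<in>b. j \<le> k}))"
    if b: "extracted_basis X b" for b
  proof -
    let ?S = "{i. i < length X \<and> breaks X i b}"
    have "b \<subseteq> ?S"
    proof
      fix i
      assume "i \<in> b"
      then have "breaks X i b"
        unfolding breaks_def by (intro bexI[of _ i] conjI order.refl vec.span_base) auto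
      with \<open>i \<in> b\<close> b show "i \<in> ?S"
        by (auto simp: extracted_basis_def)
    qed
    moreover have "finite ?S" by simp
    ultimately have "card ?S = CARD('n) \<longleftrightarrow> ?S \<subseteq> b"
      using card_extracted_basis[OF b] card_subset_eq[of ?S b] by auto
    then show ?thesis
      by (auto simp: breaks_def)
  qed
  have ext: "extracted_basis X b \<longleftrightarrow> b \<subseteq> {..<length X} \<and> inj_on ((!) X) b \<and>
      vec.independent ((!) X ` b) \<and> vec.span ((!) X ` b) = vec.span ((!) X ` {..<length X})" for b
    by (simp only: extracted_basis_def set assms)
  show ?thesis
  proof (rule set_eqI)
    fix b
    show "b \<in> no_broken_bases X \<longleftrightarrow> b \<in> {b. nb ((!) X) {..<length X} b}"
      unfolding no_broken_bases_def nb_def mem_Collect_eq using iff[of b] ext[of b] by argo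
  qed
qed

theorem proposition6p14:
  fixes X :: "(complex ^ 'n::{finite,linorder}) list"
    and p :: "nat set \<Rightarrow> 'n mpoly"
  assumes nonzero: "0 \<notin> set X"
    and spanning: "vec.span (set X) = UNIV"
    and p_in: "\<And>b. b \<in> no_broken_bases X \<Longrightarrow> p b \<in> D_space_deg X (length X - CARD('n))"
    and p_expansion: "P_class X (inv_d X {..<length X}) =
      P_class X (\<Sum>b\<in>no_broken_bases X. poly_diffop (p b) (inv_d X b))"
  shows "(\<forall>b\<in>no_broken_bases X. \<forall>c\<in>no_broken_bases X.
           dir_derivs X ({..<length X} - b) (p c) =
             (if b = c then mp_const ((- 1) ^ (length X - CARD('n))) else 0))
    \<and> inj_on p (no_broken_bases X) \<and> mpoly.independent (p ` no_broken_bases X)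
    \<and> (\<forall>c\<in>no_broken_bases X. \<forall>q\<in>D_space_deg X (length X - CARD('n)).
           (\<forall>b\<in>no_broken_bases X. dir_derivs X ({..<length X} - b) q =
             (if b = c then mp_const ((- 1) ^ (length X - CARD('n))) else 0)) \<longleftrightarrow> q = p c)"
proof -
  define x where "x = (!) X"
  define I where "I = {..<length X}"
  define k where "k = length X - CARD('n)"
  define NB where "NB = no_broken_bases X"
  have NB: "NB = {b. nb x I b}"
    unfolding NB_def x_def I_def by (rule no_broken_bases_eq_nb[OF spanning])
  have finI: "finite I" by (simp add: I_def)
  have finNB: "finite NB" unfolding NB by (rule finite_nb[OF finI])
  have nz: "x i \<noteq> 0" if "i \<in> I" for i
    using nonzero that by (auto simp: x_def I_def) (metis nth_mem)
  have xI: "x ` I = set X"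
    by (auto simp: x_def I_def in_set_conv_nth)
  have dim: "vec.dim (x ` I) = CARD('n)"
    unfolding xI using arg_cong[OF spanning, of vec.dim] by (simp only: vec.dim_span vec_dim_card)
  have cI: "card I = length X" by (simp add: I_def)
  have "vec.dim (x ` I) \<le> card I"
    using vec.dim_le_card'[of "x ` I"] card_image_le[OF finI, of x] finI by simp
  then have kI: "card I = k + vec.dim (x ` I)"
    by (simp add: k_def cI dim)
  have NB_D: "b \<subseteq> I" "finite b" "card b = CARD('n)" "card (I - b) = k" "vec.span (x ` b) = UNIV" if "b \<in> NB" for b
  proof -
    show b: "b \<subseteq> I" using that by (simp add: NB nb_def)
    then show "finite b" using finI by (rule finite_subset)
    show c: "card b = CARD('n)"
      using that card_extracted_basis[of X b] by (simp add: NB_def no_broken_bases_def)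
    show "card (I - b) = k"
      using card_Diff_subset[OF \<open>finite b\<close> b] c by (simp add: cI k_def)
    show "vec.span (x ` b) = UNIV"
      using that by (simp add: NB nb_def xI spanning)
  qed
  let ?D = "\<lambda>b. dd x (I - b)"
  have dd: "dir_derivs X (I - b) q = ?D b q" for b q
    by (simp add: dir_derivs_eq_dd finI x_def)
  have hom: "mp_homogeneous k q" if "q \<in> D_space_deg X k" for q
    using that by (simp add: D_space_deg_def)
  have pk: "p c \<in> D_space_deg X k" if "c \<in> NB" for c
    using p_in that by (simp add: k_def NB_def)
  \<comment> \<open>The sign collected when the \<open>k\<close> factors outside a basis are moved
    past the operator.\<close>
  define s :: complex where "s = (- 1) ^ k"
  have ss: "s * s = 1" by (simp add: s_def flip: power_mult_distrib)
  have s0: "s \<noteq> 0" using ss by auto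
  have main: "?D b (p c) = (if b = c then mp_const s else 0)" if b: "b \<in> NB" and c: "c \<in> NB" for b c
  proof -
    \<comment> \<open>The complement of \<open>b\<close> has \<open>k\<close> elements, equal to the
      degree of the polynomials, so the derivative is a constant.\<close>
    define \<kappa> where "\<kappa> c = Poly_Mapping.lookup (?D b (p c)) 0" for c
    have \<kappa>: "?D b (p c) = mp_const (\<kappa> c)" if "c \<in> NB" for c
    proof -
      have "mp_homogeneous (k - card (I - b)) (?D b (p c))"
        using finI by (intro dd_homogeneous hom pk that) simp
      then show ?thesis
        unfolding \<kappa>_def by (intro homogeneous_0_const) (simp add: NB_D(4)[OF b])
    qed
    define f where "f = (\<Prod>i\<in>I - b. lin_form (x i))"
    have f0: "to_fract f * recip x I = recip x b"
    proof -
      have "recip x I = inverse (to_fract f) * recip x b"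
        unfolding recip_def f_def using NB_D(1)[OF b] finI
        by (subst prod.subset_diff[of b I]) simp_all
      moreover have "f \<noteq> 0"
        unfolding f_def using nz finI by simp
      ultimately show ?thesis
        by (simp add: mult.assoc[symmetric])
    qed
    have "recip x I - (\<Sum>c\<in>NB. poly_diffop (p c) (recip x c)) \<in> low_rank CARD('n)"
    proof -
      \<comment> \<open>A coset contains its representative, which turns the equality of cosets into
        a congruence of fractions.\<close>
      have "inv_d X I + 0 \<in> P_class X (inv_d X I)"
        unfolding P_class_def R_filt_def by (intro imageI ratfun.span_zero)
      then have "inv_d X I \<in> P_class X (\<Sum>c\<in>NB. poly_diffop (p c) (inv_d X c))"
        using p_expansion by (simp add: I_def NB_def)
      then obtain r where r: "r \<in> R_filt X (CARD('n) - 1)"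
        and eq: "inv_d X I = (\<Sum>c\<in>NB. poly_diffop (p c) (inv_d X c)) + r"
        by (auto simp: P_class_def)
      have "r \<in> low_rank CARD('n)"
        using subsetD[OF R_filt_low_rank r] by simp
      with eq show ?thesis
        by (simp add: inv_d_eq_recip x_def)
    qed
    then have "to_fract f * (recip x I - (\<Sum>c\<in>NB. poly_diffop (p c) (recip x c))) \<in> low_rank CARD('n)"
      by (rule low_rank_mult_poly)
    then have 1: "recip x b - (\<Sum>c\<in>NB. to_fract f * poly_diffop (p c) (recip x c)) \<in> low_rank CARD('n)"
      by (simp add: right_diff_distrib f0 sum_distrib_left)
    have "to_fract f * poly_diffop (p c) (recip x c) - rat_scale (s * \<kappa> c) (recip x c) \<in> low_rank CARD('n)"
      if c: "c \<in> NB" for c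
    proof -
      have "to_fract (lin_form (x i)) * recip x c \<in> low_rank CARD('n)" for i
        using lin_form_mult_recip_low_rank[of c "x i" x] NB_D[OF c] nz by auto
      then have "to_fract f * poly_diffop (p c) (recip x c)
          - rat_scale ((- 1) ^ card (I - b)) (poly_diffop (?D b (p c)) (recip x c)) \<in> low_rank CARD('n)"
        unfolding f_def using finI by (intro prod_lin_form_mult_poly_diffop) simp_all
      then show ?thesis
        by (simp add: NB_D(4)[OF b] \<kappa>[OF c] poly_diffop_const s_def)
    qed
    then have "(\<Sum>c\<in>NB. to_fract f * poly_diffop (p c) (recip x c) - rat_scale (s * \<kappa> c) (recip x c))
        \<in> low_rank CARD('n)"
      by (rule low_rank_sum)
    from low_rank_add[OF 1 this]
    have "recip x b - (\<Sum>c\<in>NB. rat_scale (s * \<kappa> c) (recip x c)) \<in> low_rank CARD('n)"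
      by (simp add: sum_subtractf)
    \<comment> \<open>Kronecker coefficients put the congruence into the form of a linear relation
      among the reciprocals.\<close>
    also have "recip x b = (\<Sum>c\<in>NB. rat_scale (if c = b then 1 else 0) (recip x c))"
      using b finNB by (simp add: if_distrib[of "\<lambda>c. rat_scale c _"] cong: if_cong)
    finally have "(\<Sum>c | nb x I c. rat_scale ((if c = b then 1 else 0) - s * \<kappa> c) (recip x c))
        \<in> low_rank (vec.dim (x ` I))"
      by (simp add: sum_subtractf ratfun.scale_left_diff_distrib dim NB)
    from recip_independent[OF finI nz this] c
    have "(if c = b then 1 else 0) - s * \<kappa> c = 0"
      by (simp add: NB)
    then have "s * (s * \<kappa> c) = s * (if c = b then 1 else 0)"
      by simp
    then have "\<kappa> c = (if b = c then s else 0)"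
      using ss by (simp add: mult.assoc[symmetric])
    then show ?thesis
      using \<kappa>[OF c] by simp
  qed
  have const0: "mp_const e = (0 :: 'n mpoly) \<longleftrightarrow> e = 0" for e
    by (metis lookup_single_eq lookup_zero mp_const_0 mp_const_def)
  have inj: "inj_on p NB"
  proof (rule inj_onI)
    fix b c
    assume bc: "b \<in> NB" "c \<in> NB" "p b = p c"
    have "mp_const s = ?D b (p c)"
      using main[OF bc(1,1)] bc(3) by simp
    also have "\<dots> = (if b = c then mp_const s else 0)"
      by (rule main[OF bc(1,2)])
    finally show "b = c"
      using s0 const0 by (auto split: if_splits)
  qed
  have indep: "mpoly.independent (p ` NB)"
  proof (rule mpoly.independent_if_scalars_zero)
    show "finite (p ` NB)" using finNB by simp
    fix g q
    assume g: "(\<Sum>q\<in>p ` NB. mp_scale (g q) q) = 0" and "q \<in> p ` NB"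
    then obtain b where b: "b \<in> NB" "q = p b" by blast
    \<comment> \<open>Applying the operator of \<open>b\<close> to a relation isolates the
      coefficient of \<open>p b\<close>, up to the sign \<open>s\<close>.\<close>
    have "0 = ?D b (\<Sum>c\<in>NB. mp_const (g (p c)) * p c)"
      using g finI by (simp add: sum.reindex[OF inj] mp_scale_def)
    also have "\<dots> = (\<Sum>c\<in>NB. mp_const (g (p c)) * (if b = c then mp_const s else 0))"
      using finI b(1) by (simp add: dd_sum dd_const_mult main)
    also have "\<dots> = mp_const (g (p b) * s)"
      using finNB b(1) by (simp add: if_distrib mp_const_simps cong: if_cong)
    finally have "g (p b) * s = 0"
      using const0 by simp
    then show "g q = 0"
      using s0 b(2) by simp
  qed
  have unique: "q = p c" if c: "c \<in> NB" and q: "q \<in> D_space_deg X k"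
    and eq: "\<And>b. b \<in> NB \<Longrightarrow> ?D b q = (if b = c then mp_const s else 0)" for c q
  proof -
    have coc: "dd x Y r = 0" if "r \<in> D_space_deg X k" "Y \<subseteq> I" "vec.span (x ` (I - Y)) \<noteq> UNIV" for r Y
    proof -
      have "dir_derivs X Y r = 0"
        using that by (simp add: D_space_deg_def D_space_def cocircuit_def x_def I_def)
      then show ?thesis
        using finite_subset[OF that(2) finI] by (simp add: dir_derivs_eq_dd x_def)
    qed
    have "q - p c = 0"
    \<comment> \<open>The difference satisfies the homogeneous equations in critical degree; no
      vector has been contracted yet, so \<open>W\<close> is empty.\<close>
    proof (rule eq_0_if_derivs_0[where x = x and W = "{}" and k = k, OF finI nz])
      show "vec.span (x ` I \<union> {}) = UNIV" by (simp add: xI spanning)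
      show "mp_homogeneous k (q - p c)"
        by (intro mp_homogeneous_diff hom q pk c)
      show "card I \<le> k + vec.dim (x ` I)" using kI by simp
      show "dd x Y (q - p c) = 0" if "Y \<subseteq> I" "vec.span (x ` (I - Y)) \<noteq> vec.span (x ` I)" for Y
        using that coc[OF q] coc[OF pk[OF c]] finite_subset[OF that(1) finI]
        by (simp add: dd_diff xI spanning)
      show "dd x (I - b) (q - p c) = 0" if "nb x I b" for b
        using that finI c by (simp add: dd_diff eq main NB)
    qed auto
    then show ?thesis by simp
  qed
  show ?thesis
    unfolding NB_def[symmetric] I_def[symmetric] k_def[symmetric] s_def[symmetric] dd
    using main inj indep unique by blast
qed

end
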